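(* The Martinet structure $\mathrm{Mar}$ (with its sub-Riemannian distance and invariant measure) does not satisfy $\mathrm{MCP}(K,N)$ for any $K\in\mathbb{R}$ and any $N\in[1,\infty)$.
   Context: Martinet structure. The Engel group $\mathrm{Eng}$ is the simply connected Lie group with stratified Lie algebra $\mathfrak{e}=\mathfrak{e}_1\oplus\mathfrak{e}_2\oplus\mathfrak{e}_3$, $\mathfrak{e}_1=\mathrm{span}\{X_1,X_2\}$, $\mathfrak{e}_2=\mathrm{span}\{Y\}$, $\mathfrak{e}_3=\mathrm{span}\{Z\}$, whose only non-zero brackets are $[X_1,X_2]=Y$, $[X_1,Y]=Z$, equipped with the left-invariant sub-Riemannian structure for which $X_1,X_2$ are orthonormal. The Martinet structure is the quotient (space of right cosets) $\mathrm{Mar}=\mathrm{Eng}/\mathbb{H}$, $\mathbb{H}=\exp(\mathfrak{e}_2)$, with the sub-Riemannian distance generated by $\pi_*X_1,\pi_*X_2$ ($\pi:\mathrm{Eng}\to\mathrm{Mar}$ the quotient map, $X_1,X_2$ left-invariant), and with a measure invariant under the right action of $\mathrm{Eng}$ (unique up to a positive constant). Equivalently, in suitable global coordinates, it is $\mathbb{R}^3$ with coordinates $(x_1,x_2,z)$, with the sub-Riemannian (Carnot–Carathéodory) distance $\mathsf{d}$ for which $\partial_{x_1}$ and $\partial_{x_2}+\frac{x_1^2}{2}\partial_z$ form an orthonormal generating family, and with the Lebesgue measure. Metric measure spaces. A metric measure space $(X,\mathsf{d},\mathsf{m})$ is a complete, separable, proper, geodesic metric space with a $\sigma$-finite Borel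 measure $\mathsf{m}$ with $\operatorname{supp}\mathsf{m}=X$. $\mathrm{Geo}(X)=\{\gamma\in C([0,1],X):\mathsf{d}(\gamma_s,\gamma_t)=|s-t|\mathsf{d}(\gamma_0,\gamma_1)\}$, $e_t(\gamma)=\gamma_t$. $\mathcal{P}_c(X)$ is the set of compactly supported Borel probability measures. $\mathrm{OptGeo}(\mu_0,\mu_1)$ is the set of probability measures $\nu$ on $\mathrm{Geo}(X)$ such that $(e_0,e_1)_\sharp\nu$ is an optimal coupling of $\mu_0,\mu_1$ for the cost $\mathsf{d}^2$. Distortion coefficients. For $K\in\mathbb{R}$, $N\in[1,\infty)$, $t\in[0,1]$, $\theta\ge 0$: $\tau^{t}_{K,N}(\theta)=\infty$ if $K>0$ and $K\theta^2\ge (N-1)\pi^2$; $\tau^{t}_{K,N}(\theta)=t^{1/N}\Big(\frac{\sin(t\theta\sqrt{K/(N-1)})}{\sin(\theta\sqrt{K/(N-1)})}\Big)^{1-1/N}$ if $0<K\theta^2<(N-1)\pi^2$; $\tau^{t}_{K,N}(\theta)=t$ if $K\theta^2=0$, or $K<0$ and $N=1$; $\tau^{t}_{K,N}(\theta)=t^{1/N}\Big(\frac{\sinh(t\theta\sqrt{|K|/(N-1)})}{\sinh(\theta\sqrt{|K|/(N-1)})}\Big)^{1-1/N}$ if $K\theta^2<0$ (and $N>1$). Measure contraction property. $(X,\mathsf{d},\mathsf{m})$ satisfies $\mathrm{MCP}(K,N)$ if for any $o\in X$ and any $\mu_0\in\mathcal{P}_c(X)$ of the form $\mu_0=\frac{1}{\mathsf{m}(A)}\mathsf{m}|_A$,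 with $A\subset X$ Borel and $0<\mathsf{m}(A)<\infty$, there exists $\nu\in\mathrm{OptGeo}(\mu_0,\delta_o)$ such that $\frac{1}{\mathsf{m}(A)}\mathsf{m}\ge (e_t)_\sharp\big(\tau^{(1-t)}_{K,N}(\mathsf{d}(\gamma_0,\gamma_1))^N\nu\big)$ for all $t\in[0,1]$. *)

theory Defs
  imports "HOL-Probability.Probability"
begin

section \<open>Measures on metric spaces\<close>

text \<open>Metric spaces are given by the library type \<^typ>\<open>'a metric\<close>, so that the distance need not
  be the one of a type class instance.\<close>

definition mborel :: "'a metric \<Rightarrow> 'a measure" where
  "mborel X = sigma (mspace X) {U. openin (mtopology_of X) U}"

definition msupport :: "'a metric \<Rightarrow> 'a measure \<Rightarrow> 'a set" where
  "msupport X \<mu> = {x \<in> mspace X. \<forall>U. openin (mtopology_of X) U \<and> x \<in> U \<longrightarrow> 0 < emeasure \<mu> U}"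

definition Pc :: "'a metric \<Rightarrow> 'a measure set" where
  "Pc X = {\<mu>. sets \<mu> = sets (mborel X) \<and> prob_space \<mu> \<and>
              compactin (mtopology_of X) (msupport X \<mu>)}"

text \<open>\<open>Geo X\<close> is a subspace of \<open>C([0,1], X)\<close> with the uniform distance. Its elements are functions
  on the real line that are \<^term>\<open>undefined\<close> outside the unit interval.\<close>

definition Geo :: "'a metric \<Rightarrow> (real \<Rightarrow> 'a) metric" where
  "Geo X = submetric (cfunspace (top_of_set {0..1}) X)
     {\<gamma>. \<forall>s\<in>{0..1}. \<forall>t\<in>{0..1}. mdist X (\<gamma> s) (\<gamma> t) = \<bar>s - t\<bar> * mdist X (\<gamma> 0) (\<gamma> 1)}"

text \<open>Couplings live on the product of the Borel sigma-algebras, which is the Borel sigma-algebra of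
  the product because metric measure spaces are separable.\<close>

definition couplings :: "'a metric \<Rightarrow> 'a measure \<Rightarrow> 'a measure \<Rightarrow> ('a \<times> 'a) measure set" where
  "couplings X \<mu>0 \<mu>1 = {q. sets q = sets (mborel X \<Otimes>\<^sub>M mborel X) \<and> prob_space q \<and>
     distr q (mborel X) fst = \<mu>0 \<and> distr q (mborel X) snd = \<mu>1}"

definition transport_cost :: "'a metric \<Rightarrow> ('a \<times> 'a) measure \<Rightarrow> ennreal" where
  "transport_cost X q = (\<integral>\<^sup>+ (x, y). ennreal ((mdist X x y)\<^sup>2) \<partial>q)"

definition optimal_couplings :: "'a metric \<Rightarrow> 'a measure \<Rightarrow> 'a measure \<Rightarrow> ('a \<times> 'a) measure set" where
  "optimal_couplings X \<mu>0 \<mu>1 =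
     {q \<in> couplings X \<mu>0 \<mu>1. \<forall>q' \<in> couplings X \<mu>0 \<mu>1. transport_cost X q \<le> transport_cost X q'}"

definition OptGeo :: "'a metric \<Rightarrow> 'a measure \<Rightarrow> 'a measure \<Rightarrow> (real \<Rightarrow> 'a) measure set" where
  "OptGeo X \<mu>0 \<mu>1 = {\<nu>. sets \<nu> = sets (mborel (Geo X)) \<and> prob_space \<nu> \<and>
     distr \<nu> (mborel X \<Otimes>\<^sub>M mborel X) (\<lambda>\<gamma>. (\<gamma> 0, \<gamma> 1)) \<in> optimal_couplings X \<mu>0 \<mu>1}"


section \<open>The measure contraction property\<close>

text \<open>The cases are read in order: for \<open>N = 1\<close>, \<open>K > 0\<close> and \<open>\<theta> = 0\<close> the coefficient is infinite.\<close>

definition tau :: "real \<Rightarrow> real \<Rightarrow> real \<Rightarrow> real \<Rightarrow> ennreal" where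
  "tau K N t \<theta> =
     (if 0 < K \<and> (N - 1) * pi\<^sup>2 \<le> K * \<theta>\<^sup>2 then \<infinity>
      else if 0 < K * \<theta>\<^sup>2 then
        ennreal (t powr (1 / N) *
          (sin (t * \<theta> * sqrt (K / (N - 1))) / sin (\<theta> * sqrt (K / (N - 1)))) powr (1 - 1 / N))
      else if K * \<theta>\<^sup>2 = 0 \<or> (K < 0 \<and> N = 1) then ennreal t
      else
        ennreal (t powr (1 / N) *
          (sinh (t * \<theta> * sqrt (\<bar>K\<bar> / (N - 1))) / sinh (\<theta> * sqrt (\<bar>K\<bar> / (N - 1)))) powr (1 - 1 / N)))"

definition ennreal_powr :: "ennreal \<Rightarrow> real \<Rightarrow> ennreal" where
  "ennreal_powr x a = (if x = \<infinity> then \<infinity> else ennreal (enn2real x powr a))"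

definition MCP :: "'a metric \<Rightarrow> 'a measure \<Rightarrow> real \<Rightarrow> real \<Rightarrow> bool" where
  "MCP X m K N \<longleftrightarrow>
     (\<forall>x0 \<in> mspace X. \<forall>A \<in> sets (mborel X).
        0 < emeasure m A \<and> emeasure m A < \<infinity> \<and> uniform_measure m A \<in> Pc X \<longrightarrow>
        (\<exists>\<nu> \<in> OptGeo X (uniform_measure m A) (return (mborel X) x0).
           \<forall>t \<in> {0..1}. \<forall>B \<in> sets (mborel X).
             emeasure
               (distr (density \<nu> (\<lambda>\<gamma>. ennreal_powr (tau K N (1 - t) (mdist X (\<gamma> 0) (\<gamma> 1))) N))
                  (mborel X) (\<lambda>\<gamma>. \<gamma> t)) B
             \<le> emeasure m B / emeasure m A))"


section \<open>Sub-Riemannian distances\<close>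

text \<open>A horizontal curve is an absolutely continuous solution of
  \<open>\<gamma>' = u\<^sub>1 X\<^sub>1(\<gamma>) + u\<^sub>2 X\<^sub>2(\<gamma>)\<close> almost everywhere on \<open>[0,1]\<close> with an integrable control \<open>u = (u\<^sub>1, u\<^sub>2)\<close>; the
  equation is written in integrated form. As \<open>X\<^sub>1, X\<^sub>2\<close> are orthonormal, the speed is the
  Euclidean norm of \<open>u\<close>.\<close>

definition velocity ::
  "('a::euclidean_space \<Rightarrow> 'a) \<Rightarrow> ('a \<Rightarrow> 'a) \<Rightarrow> (real \<Rightarrow> real \<times> real) \<Rightarrow> (real \<Rightarrow> 'a) \<Rightarrow> real \<Rightarrow> 'a" where
  "velocity X1 X2 u \<gamma> s = fst (u s) *\<^sub>R X1 (\<gamma> s) + snd (u s) *\<^sub>R X2 (\<gamma> s)"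

definition horizontal ::
  "('a::euclidean_space \<Rightarrow> 'a) \<Rightarrow> ('a \<Rightarrow> 'a) \<Rightarrow> (real \<Rightarrow> real \<times> real) \<Rightarrow> (real \<Rightarrow> 'a) \<Rightarrow> bool" where
  "horizontal X1 X2 u \<gamma> \<longleftrightarrow> u absolutely_integrable_on {0..1} \<and>
     (\<forall>t \<in> {0..1}. (velocity X1 X2 u \<gamma> has_integral \<gamma> t - \<gamma> 0) {0..t})"

definition sr_lengths :: "('a::euclidean_space \<Rightarrow> 'a) \<Rightarrow> ('a \<Rightarrow> 'a) \<Rightarrow> 'a \<Rightarrow> 'a \<Rightarrow> real set" where
  "sr_lengths X1 X2 p q =
     {integral {0..1} (\<lambda>s. norm (u s)) | u \<gamma>. horizontal X1 X2 u \<gamma> \<and> \<gamma> 0 = p \<and> \<gamma> 1 = q}"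

definition sr_dist :: "('a::euclidean_space \<Rightarrow> 'a) \<Rightarrow> ('a \<Rightarrow> 'a) \<Rightarrow> 'a \<Rightarrow> 'a \<Rightarrow> real" where
  "sr_dist X1 X2 p q = Inf (sr_lengths X1 X2 p q)"

lemma sr_lengthsI:
  assumes "horizontal X1 X2 u \<gamma>" "\<gamma> 0 = p" "\<gamma> 1 = q"
    and "((\<lambda>s. norm (u s)) has_integral l) {0..1}"
  shows "l \<in> sr_lengths X1 X2 p q"
  unfolding sr_lengths_def
  by (intro CollectI exI[of _ u] exI[of _ \<gamma>]) (use assms in \<open>auto simp: integral_unique\<close>)

lemma sr_lengths_nonneg: "l \<in> sr_lengths X1 X2 p q \<Longrightarrow> 0 \<le> l"
  unfolding sr_lengths_def horizontal_def
  by (auto intro!: integral_nonneg simp: absolutely_integrable_on_def)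

lemma sr_lengths_bdd: "bdd_below (sr_lengths X1 X2 p q)"
  using sr_lengths_nonneg by (intro bdd_belowI[of _ 0]) blast

lemma sr_lengths_refl: "0 \<in> sr_lengths X1 X2 p p"
proof -
  have "horizontal X1 X2 (\<lambda>_. 0) (\<lambda>_. p)"
    by (auto simp: horizontal_def velocity_def[abs_def])
  then show ?thesis
    unfolding sr_lengths_def by (intro CollectI exI[of _ "\<lambda>_. 0"] exI[of _ "\<lambda>_. p"]) simp
qed

lemma has_integral_reverse:
  fixes f :: "real \<Rightarrow> 'b::euclidean_space"
  assumes "(f has_integral i) {a..b}"
  shows "((\<lambda>s. f (1 - s)) has_integral i) {1 - b..1 - a}"
proof (cases "a \<le> b")
  case True
  have "((\<lambda>s. f ((-1) *\<^sub>R s + 1)) has_integral (1 / \<bar>- 1\<bar> ^ DIM(real)) *\<^sub>R i)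
     ((\<lambda>x. (1 / - 1) *\<^sub>R x + - ((1 / - 1) *\<^sub>R 1)) ` cbox a b)"
    using assms by (intro has_integral_affinity) auto
  moreover have "(\<lambda>x::real. 1 - x) ` {a..b} = {1 - b..1 - a}"
    by auto
  ultimately show ?thesis by (simp add: algebra_simps)
next
  case False
  with assms show ?thesis by simp
qed

lemma sr_lengths_sym:
  assumes "l \<in> sr_lengths X1 X2 p q"
  shows "l \<in> sr_lengths X1 X2 q p"
proof -
  obtain u \<gamma> where u: "horizontal X1 X2 u \<gamma>" "\<gamma> 0 = p" "\<gamma> 1 = q"
    and l: "l = integral {0..1} (\<lambda>s. norm (u s))"
    using assms unfolding sr_lengths_def by auto
  define v where "v = (\<lambda>s. - u (1 - s))"
  define \<eta> where "\<eta> = (\<lambda>s. \<gamma> (1 - s))"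
  have au: "u integrable_on {0..1}" "(\<lambda>s. norm (u s)) integrable_on {0..1}"
    using u by (auto simp: horizontal_def absolutely_integrable_on_def)
  have "v integrable_on {0..1}"
    unfolding v_def using has_integral_reverse[OF integrable_integral[OF au(1)]]
    by (intro integrable_neg) (auto simp: integrable_on_def)
  moreover have n: "((\<lambda>s. norm (v s)) has_integral l) {0..1}"
    unfolding v_def l using has_integral_reverse[OF integrable_integral[OF au(2)]] by simp
  ultimately have av: "v absolutely_integrable_on {0..1}"
    by (auto simp: absolutely_integrable_on_def integrable_on_def)
  have "(velocity X1 X2 v \<eta> has_integral \<eta> t - \<eta> 0) {0..t}" if t: "t \<in> {0..1}" for t
  proof -
    have 1: "(velocity X1 X2 u \<gamma> has_integral \<gamma> 1 - \<gamma> 0) {0..1}"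
      and 2: "(velocity X1 X2 u \<gamma> has_integral \<gamma> (1-t) - \<gamma> 0) {0..1-t}"
      using u(1) t by (auto simp: horizontal_def)
    have "velocity X1 X2 u \<gamma> integrable_on {1-t..1}"
      by (rule integrable_subinterval_real[of _ 0 1]) (use 1 t in \<open>auto simp: integrable_on_def\<close>)
    then obtain i where i: "(velocity X1 X2 u \<gamma> has_integral i) {1-t..1}"
      by (auto simp: integrable_on_def)
    have "(velocity X1 X2 u \<gamma> has_integral (\<gamma> (1-t) - \<gamma> 0) + i) {0..1}"
      by (rule has_integral_combine[OF _ _ 2 i]) (use t in auto)
    then have "i = \<gamma> 1 - \<gamma> (1 - t)"
      using has_integral_unique[OF 1] by (metis (no_types, lifting) add_diff_cancel_left' diff_diff_eq2 diff_add_cancel)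
    with has_integral_reverse[OF i]
    have "((\<lambda>s. velocity X1 X2 u \<gamma> (1 - s)) has_integral \<gamma> 1 - \<gamma> (1 - t)) {0..t}"
      by simp
    from has_integral_neg[OF this] show ?thesis
      by (simp add: velocity_def[abs_def] v_def \<eta>_def)
  qed
  then have "horizontal X1 X2 v \<eta>" using av by (simp add: horizontal_def)
  moreover have "\<eta> 0 = q" "\<eta> 1 = p" using u by (auto simp: \<eta>_def)
  ultimately show ?thesis
    using n by (intro sr_lengthsI)
qed

definition concat2 :: "(real \<Rightarrow> 'b::real_vector) \<Rightarrow> (real \<Rightarrow> 'b) \<Rightarrow> real \<Rightarrow> 'b" where
  "concat2 f g s = (if s \<le> 1/2 then 2 *\<^sub>R f (2 * s) else 2 *\<^sub>R g (2 * s - 1))"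

lemma concat2_left:
  fixes f :: "real \<Rightarrow> 'b::euclidean_space"
  assumes "(f has_integral i) {0..2 * t}" "t \<le> 1/2"
  shows "(concat2 f g has_integral i) {0..t}"
proof -
  have "((\<lambda>x. f (2 *\<^sub>R x + 0)) has_integral (i /\<^sub>R 2 ^ DIM(real))) (cbox ((0 - 0) /\<^sub>R 2) ((2 * t - 0) /\<^sub>R 2))"
    using assms by (intro has_integral_affinity') auto
  then have "((\<lambda>x. f (2 * x)) has_integral (i /\<^sub>R 2)) {0..t}" by simp
  then have "((\<lambda>x. 2 *\<^sub>R f (2 * x)) has_integral 2 *\<^sub>R (i /\<^sub>R 2)) {0..t}"
    by (rule has_integral_cmul)
  then have "((\<lambda>x. 2 *\<^sub>R f (2 * x)) has_integral i) {0..t}" by simp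
  then show ?thesis
    by (rule has_integral_eq[rotated]) (use assms(2) in \<open>auto simp: concat2_def\<close>)
qed

lemma concat2_right:
  fixes f g :: "real \<Rightarrow> 'b::euclidean_space"
  assumes f: "(f has_integral i) {0..1}" and g: "(g has_integral j) {0..2 * t - 1}" and t: "1/2 \<le> t"
  shows "(concat2 f g has_integral i + j) {0..t}"
proof -
  have 1: "(concat2 f g has_integral i) {0..1/2}"
    by (rule concat2_left) (use f in auto)
  have "((\<lambda>x. g (2 *\<^sub>R x + -1)) has_integral (j /\<^sub>R 2 ^ DIM(real))) (cbox ((0 - -1) /\<^sub>R 2) ((2 * t - 1 - -1) /\<^sub>R 2))"
    using g by (intro has_integral_affinity') auto
  then have "((\<lambda>x. g (2 * x - 1)) has_integral (j /\<^sub>R 2)) {1/2..t}" by simp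
  then have "((\<lambda>x. 2 *\<^sub>R g (2 * x - 1)) has_integral 2 *\<^sub>R (j /\<^sub>R 2)) {1/2..t}"
    by (rule has_integral_cmul)
  then have "((\<lambda>x. 2 *\<^sub>R g (2 * x - 1)) has_integral j) {1/2..t}" by simp
  then have 2: "(concat2 f g has_integral j) {1/2..t}"
    by (rule has_integral_spike_finite[rotated 2, where S="{1/2}"]) (auto simp: concat2_def)
  show ?thesis
    by (rule has_integral_combine[OF _ _ 1 2]) (use t in auto)
qed

lemma sr_lengths_trans:
  assumes "l1 \<in> sr_lengths X1 X2 p q" "l2 \<in> sr_lengths X1 X2 q r"
  shows "l1 + l2 \<in> sr_lengths X1 X2 p r"
proof -
  obtain u \<gamma> where u: "horizontal X1 X2 u \<gamma>" "\<gamma> 0 = p" "\<gamma> 1 = q"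
    and l1: "l1 = integral {0..1} (\<lambda>s. norm (u s))"
    using assms(1) unfolding sr_lengths_def by auto
  obtain v \<eta> where v: "horizontal X1 X2 v \<eta>" "\<eta> 0 = q" "\<eta> 1 = r"
    and l2: "l2 = integral {0..1} (\<lambda>s. norm (v s))"
    using assms(2) unfolding sr_lengths_def by auto
  define w where "w = concat2 u v"
  define \<zeta> where "\<zeta> = (\<lambda>s. if s \<le> 1/2 then \<gamma> (2 * s) else \<eta> (2 * s - 1))"
  have au: "u integrable_on {0..1}" "(\<lambda>s. norm (u s)) integrable_on {0..1}"
    and av: "v integrable_on {0..1}" "(\<lambda>s. norm (v s)) integrable_on {0..1}"
    using u v by (auto simp: horizontal_def absolutely_integrable_on_def)
  have "(w has_integral integral {0..1} u + integral {0..1} v) {0..1}"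
    unfolding w_def by (rule concat2_right) (use au av in auto)
  moreover have n: "((\<lambda>s. norm (w s)) has_integral l1 + l2) {0..1}"
  proof -
    have "(\<lambda>s. norm (w s)) = concat2 (\<lambda>s. norm (u s)) (\<lambda>s. norm (v s))"
      by (auto simp: w_def concat2_def fun_eq_iff)
    moreover have "(concat2 (\<lambda>s. norm (u s)) (\<lambda>s. norm (v s)) has_integral l1 + l2) {0..1}"
      unfolding l1 l2 by (rule concat2_right) (use au av in auto)
    ultimately show ?thesis by simp
  qed
  ultimately have aw: "w absolutely_integrable_on {0..1}"
    by (auto simp: absolutely_integrable_on_def integrable_on_def)
  have vel: "velocity X1 X2 w \<zeta> = concat2 (velocity X1 X2 u \<gamma>) (velocity X1 X2 v \<eta>)"
    by (auto simp: fun_eq_iff velocity_def w_def \<zeta>_def concat2_def scaleR_add_right)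
  have "(velocity X1 X2 w \<zeta> has_integral \<zeta> t - \<zeta> 0) {0..t}" if t: "t \<in> {0..1}" for t
  proof (cases "t \<le> 1/2")
    case True
    then have "(velocity X1 X2 u \<gamma> has_integral \<gamma> (2 * t) - \<gamma> 0) {0..2 * t}"
      using u(1) t by (auto simp: horizontal_def)
    from concat2_left[OF this True] show ?thesis
      unfolding vel using True by (simp add: \<zeta>_def)
  next
    case False
    have "(velocity X1 X2 u \<gamma> has_integral \<gamma> 1 - \<gamma> 0) {0..1}"
      using u(1) by (auto simp: horizontal_def)
    moreover have "(velocity X1 X2 v \<eta> has_integral \<eta> (2 * t - 1) - \<eta> 0) {0..2 * t - 1}"
      using v(1) t False by (auto simp: horizontal_def)
    ultimately have "(velocity X1 X2 w \<zeta> has_integral (\<gamma> 1 - \<gamma> 0) + (\<eta> (2 * t - 1) - \<eta> 0)) {0..t}"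
      unfolding vel by (rule concat2_right) (use False in auto)
    then show ?thesis
      using False u v by (simp add: \<zeta>_def)
  qed
  then have "horizontal X1 X2 w \<zeta>" using aw by (simp add: horizontal_def)
  moreover have "\<zeta> 0 = p" "\<zeta> 1 = r" using u v by (auto simp: \<zeta>_def)
  ultimately show ?thesis
    using n by (intro sr_lengthsI)
qed

lemma Metric_space_sr_dist:
  assumes conn: "\<And>p q. sr_lengths X1 X2 p q \<noteq> {}"
    and pos: "\<And>p q. sr_dist X1 X2 p q = 0 \<Longrightarrow> p = q"
  shows "Metric_space UNIV (sr_dist X1 X2)"
proof
  show nn: "0 \<le> sr_dist X1 X2 p q" for p q
    unfolding sr_dist_def using conn sr_lengths_nonneg by (intro cInf_greatest) auto
  show "sr_dist X1 X2 p q = sr_dist X1 X2 q p" for p q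
    unfolding sr_dist_def using sr_lengths_sym by (metis subset_antisym subsetI)
  show "(sr_dist X1 X2 p q = 0) = (p = q)" for p q
  proof
    assume "p = q"
    then have "sr_dist X1 X2 p q \<le> 0"
      unfolding sr_dist_def using sr_lengths_refl sr_lengths_bdd by (intro cInf_lower) auto
    with nn[of p q] show "sr_dist X1 X2 p q = 0" by simp
  qed (rule pos)
  show "sr_dist X1 X2 p r \<le> sr_dist X1 X2 p q + sr_dist X1 X2 q r" for p q r
  proof -
    have 1: "sr_dist X1 X2 p r - l2 \<le> l1"
      if "l1 \<in> sr_lengths X1 X2 p q" "l2 \<in> sr_lengths X1 X2 q r" for l1 l2
      using cInf_lower[OF sr_lengths_trans[OF that] sr_lengths_bdd] by (simp add: sr_dist_def)
    have "sr_dist X1 X2 p r - l2 \<le> sr_dist X1 X2 p q" if "l2 \<in> sr_lengths X1 X2 q r" for l2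
      unfolding sr_dist_def[of _ _ p q] using conn 1[OF _ that] by (intro cInf_greatest) auto
    then have "sr_dist X1 X2 p r - sr_dist X1 X2 p q \<le> l2" if "l2 \<in> sr_lengths X1 X2 q r" for l2
      using that by force
    then have "sr_dist X1 X2 p r - sr_dist X1 X2 p q \<le> sr_dist X1 X2 q r"
      unfolding sr_dist_def[of _ _ q r] using conn by (intro cInf_greatest) auto
    then show ?thesis by simp
  qed
qed


section \<open>The Martinet structure\<close>

definition mar_X1 :: "real \<times> real \<times> real \<Rightarrow> real \<times> real \<times> real" where
  "mar_X1 = (\<lambda>(x1, x2, z). (1, 0, 0))"

definition mar_X2 :: "real \<times> real \<times> real \<Rightarrow> real \<times> real \<times> real" where
  "mar_X2 = (\<lambda>(x1, x2, z). (0, 1, x1\<^sup>2 / 2))"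

definition mar_dist :: "real \<times> real \<times> real \<Rightarrow> real \<times> real \<times> real \<Rightarrow> real" where
  "mar_dist = sr_dist mar_X1 mar_X2"

definition Mar :: "(real \<times> real \<times> real) metric" where
  "Mar = metric (UNIV, mar_dist)"

lemma mar_move1: "\<exists>l. l \<in> sr_lengths mar_X1 mar_X2 (x1, x2, z) (x1 + a, x2, z)"
proof -
  have "((\<lambda>s::real. (a, 0::real, 0::real)) has_integral (t *\<^sub>R (a, 0, 0))) {0..t}" if "0 \<le> t" for t :: real
    using has_integral_const_real[of "(a, 0::real, 0::real)" 0 t] that by simp
  then have "horizontal mar_X1 mar_X2 (\<lambda>_. (a, 0)) (\<lambda>t. (x1 + t * a, x2, z))"
    by (simp add: horizontal_def velocity_def[abs_def] mar_X1_def mar_X2_def zero_prod_def)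
  moreover have "(\<lambda>t. (x1 + t * a, x2, z)) 0 = (x1, x2, z)" "(\<lambda>t. (x1 + t * a, x2, z)) 1 = (x1 + a, x2, z)"
    by auto
  ultimately show ?thesis unfolding sr_lengths_def by blast
qed

lemma mar_move2: "\<exists>l. l \<in> sr_lengths mar_X1 mar_X2 (x1, x2, z) (x1, x2 + b, z + b * (x1\<^sup>2 / 2))"
proof -
  have "((\<lambda>s::real. (0::real, b, b * x1\<^sup>2 / 2)) has_integral (t *\<^sub>R (0, b, b * x1\<^sup>2 / 2))) {0..t}"
    if "0 \<le> t" for t :: real
    using has_integral_const_real[of "(0::real, b, b * x1\<^sup>2 / 2)" 0 t] that by simp
  then have "horizontal mar_X1 mar_X2 (\<lambda>_. (0, b)) (\<lambda>t. (x1, x2 + t * b, z + t * b * (x1\<^sup>2 / 2)))"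
    by (simp add: horizontal_def velocity_def[abs_def] mar_X1_def mar_X2_def mult.assoc)
  moreover have "(\<lambda>t. (x1, x2 + t * b, z + t * b * (x1\<^sup>2 / 2))) 0 = (x1, x2, z)"
    "(\<lambda>t. (x1, x2 + t * b, z + t * b * (x1\<^sup>2 / 2))) 1 = (x1, x2 + b, z + b * (x1\<^sup>2 / 2))"
    by auto
  ultimately show ?thesis unfolding sr_lengths_def by blast
qed

lemma mar_connected: "sr_lengths mar_X1 mar_X2 p q \<noteq> {}"
proof -
  define R where "R = (\<lambda>p q. \<exists>l. l \<in> sr_lengths mar_X1 mar_X2 p q)"
  have tr[trans]: "R p r" if "R p q" "R q r" for p q r
    using that sr_lengths_trans unfolding R_def by blast
  obtain x1 x2 z y1 y2 w where pq: "p = (x1, x2, z)" "q = (y1, y2, w)"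
    by (metis prod.collapse)
  define b where "b = 2 * (w - z)"
  have "R p (0, x2, z)" using mar_move1[of x1 x2 z "- x1"] by (simp add: R_def pq)
  also have "R (0, x2, z) (0, y2, z)" using mar_move2[of 0 x2 z "y2 - x2"] by (simp add: R_def)
  also have "R (0, y2, z) (1, y2, z)" using mar_move1[of 0 y2 z 1] by (simp add: R_def)
  also have "R (1, y2, z) (1, y2 + b, w)"
  proof -
    have "z + b * (1\<^sup>2 / 2) = w" by (simp add: b_def field_simps)
    then show ?thesis using mar_move2[of 1 y2 z b] by (simp only: R_def)
  qed
  also have "R (1, y2 + b, w) (0, y2 + b, w)" using mar_move1[of 1 "y2 + b" w "-1"] by (simp add: R_def)
  also have "R (0, y2 + b, w) (0, y2, w)" using mar_move2[of 0 "y2 + b" w "-b"] by (simp add: R_def)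
  also have "R (0, y2, w) q" using mar_move1[of 0 y2 w y1] by (simp add: R_def pq)
  finally show ?thesis by (auto simp: R_def)
qed

lemma mar_length_bounds:
  assumes l: "l \<in> sr_lengths mar_X1 mar_X2 (x1, x2, z) (y1, y2, w)"
  shows "\<bar>y1 - x1\<bar> \<le> l" "\<bar>y2 - x2\<bar> \<le> l" "\<bar>w - z\<bar> \<le> (\<bar>x1\<bar> + l)\<^sup>2 / 2 * l"
proof -
  obtain u \<gamma> where h: "horizontal mar_X1 mar_X2 u \<gamma>" and e: "\<gamma> 0 = (x1, x2, z)" "\<gamma> 1 = (y1, y2, w)"
    and l_eq: "l = integral {0..1} (\<lambda>s. norm (u s))"
    using l unfolding sr_lengths_def by auto
  have un: "(\<lambda>s. norm (u s)) integrable_on {0..1}"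
    using h by (auto simp: horizontal_def absolutely_integrable_on_def)
  have l0: "0 \<le> l" using l sr_lengths_nonneg by blast
  have n: "\<bar>fst (u s)\<bar> \<le> norm (u s)" "\<bar>snd (u s)\<bar> \<le> norm (u s)" for s
    by (metis norm_fst_le real_norm_def prod.collapse) (metis norm_snd_le real_norm_def prod.collapse)
  have vel: "velocity mar_X1 mar_X2 u \<gamma> s = (fst (u s), snd (u s), snd (u s) * ((fst (\<gamma> s))\<^sup>2 / 2))" for s
    by (simp add: velocity_def mar_X1_def mar_X2_def split: prod.split)
  have I: "(velocity mar_X1 mar_X2 u \<gamma> has_integral \<gamma> t - \<gamma> 0) {0..t}" if "t \<in> {0..1}" for t
    using h that by (auto simp: horizontal_def)
  have I1: "((\<lambda>s. fst (u s)) has_integral fst (\<gamma> t - \<gamma> 0)) {0..t}" if "t \<in> {0..1}" for t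
    using has_integral_linear[OF I[OF that] bounded_linear_fst] by (simp add: o_def vel)
  have I2: "((\<lambda>s. snd (u s)) has_integral fst (snd (\<gamma> 1 - \<gamma> 0))) {0..1}"
    using has_integral_linear[OF I[of 1] bounded_linear_compose[OF bounded_linear_fst bounded_linear_snd]]
    by (simp add: o_def vel)
  have I3: "((\<lambda>s. snd (u s) * ((fst (\<gamma> s))\<^sup>2 / 2)) has_integral snd (snd (\<gamma> 1 - \<gamma> 0))) {0..1}"
    using has_integral_linear[OF I[of 1] bounded_linear_compose[OF bounded_linear_snd bounded_linear_snd]]
    by (simp add: o_def vel)
  have x1b: "\<bar>fst (\<gamma> t) - x1\<bar> \<le> l" if t: "t \<in> {0..1}" for t
  proof -
    have unt: "(\<lambda>s. norm (u s)) integrable_on {0..t}"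
      by (rule integrable_subinterval_real[OF un]) (use t in auto)
    have "norm (fst (\<gamma> t - \<gamma> 0)) \<le> integral {0..t} (\<lambda>s. norm (u s))"
      unfolding integral_unique[OF I1[OF t], symmetric]
      by (rule integral_norm_bound_integral) (use I1[OF t] unt n(1) in auto)
    also have "\<dots> \<le> l"
      unfolding l_eq by (rule integral_subset_le) (use t un unt in auto)
    finally show ?thesis using e by simp
  qed
  show "\<bar>y1 - x1\<bar> \<le> l" using x1b[of 1] e by simp
  have "norm (fst (snd (\<gamma> 1 - \<gamma> 0))) \<le> l"
    unfolding l_eq integral_unique[OF I2, symmetric]
    by (rule integral_norm_bound_integral) (use I2 un n(2) in auto)
  then show "\<bar>y2 - x2\<bar> \<le> l" using e by simp
  have b: "norm (snd (u s) * ((fst (\<gamma> s))\<^sup>2 / 2)) \<le> (\<bar>x1\<bar> + l)\<^sup>2 / 2 * norm (u s)" if "s \<in> {0..1}" for s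
  proof -
    have "\<bar>fst (\<gamma> s)\<bar> \<le> \<bar>x1\<bar> + l" using x1b[OF that] by linarith
    then have "(fst (\<gamma> s))\<^sup>2 \<le> (\<bar>x1\<bar> + l)\<^sup>2"
      by (metis abs_ge_zero power2_abs power_mono)
    then have "\<bar>snd (u s)\<bar> * ((fst (\<gamma> s))\<^sup>2 / 2) \<le> norm (u s) * ((\<bar>x1\<bar> + l)\<^sup>2 / 2)"
      by (intro mult_mono n) auto
    then show ?thesis by (simp add: abs_mult mult.commute)
  qed
  have "norm (snd (snd (\<gamma> 1 - \<gamma> 0))) \<le> integral {0..1} (\<lambda>s. (\<bar>x1\<bar> + l)\<^sup>2 / 2 * norm (u s))"
    unfolding integral_unique[OF I3, symmetric]
    by (rule integral_norm_bound_integral) (use I3 un b in \<open>auto intro: integrable_on_mult_right\<close>)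
  also have "\<dots> = (\<bar>x1\<bar> + l)\<^sup>2 / 2 * l"
    unfolding l_eq by (rule integral_mult_right)
  finally show "\<bar>w - z\<bar> \<le> (\<bar>x1\<bar> + l)\<^sup>2 / 2 * l" using e by simp
qed

lemma mar_dist_eq_0:
  assumes "mar_dist p q = 0"
  shows "p = q"
proof -
  obtain x1 x2 z y1 y2 w where pq: "p = (x1, x2, z)" "q = (y1, y2, w)"
    by (metis prod.collapse)
  have ev: "\<bar>y1 - x1\<bar> \<le> e \<and> \<bar>y2 - x2\<bar> \<le> e \<and> \<bar>w - z\<bar> \<le> (\<bar>x1\<bar> + e)\<^sup>2 / 2 * e" if "0 < e" for e
  proof -
    have "Inf (sr_lengths mar_X1 mar_X2 p q) < e"
      using assms that by (simp add: mar_dist_def sr_dist_def)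
    then obtain l where l: "l \<in> sr_lengths mar_X1 mar_X2 p q" "l < e"
      using cInf_lessD[OF mar_connected] by blast
    have l0: "0 \<le> l" using l sr_lengths_nonneg by blast
    have "(\<bar>x1\<bar> + l)\<^sup>2 / 2 * l \<le> (\<bar>x1\<bar> + e)\<^sup>2 / 2 * e"
      using l l0 by (intro mult_mono divide_right_mono power_mono) auto
    then show ?thesis
      using mar_length_bounds[OF l(1)[unfolded pq]] l(2) by linarith
  qed
  have lim: "((\<lambda>e. (\<bar>x1\<bar> + e)\<^sup>2 / 2 * e) \<longlongrightarrow> (\<bar>x1\<bar> + 0)\<^sup>2 / 2 * 0) (at_right (0::real))"
    by (intro tendsto_intros) auto
  have "\<bar>w - z\<bar> \<le> (\<bar>x1\<bar> + 0)\<^sup>2 / 2 * 0"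
    by (rule tendsto_lowerbound[OF lim]) (use ev in \<open>auto intro: eventually_mono[OF eventually_at_right_less]\<close>)
  moreover have "\<bar>y1 - x1\<bar> \<le> 0" "\<bar>y2 - x2\<bar> \<le> 0"
    using ev by (auto intro: field_le_epsilon simp del: abs_le_zero_iff)
  ultimately show ?thesis by (simp add: pq)
qed

lemma Metric_space_mar_dist: "Metric_space UNIV mar_dist"
  unfolding mar_dist_def
  by (rule Metric_space_sr_dist) (auto simp: mar_connected mar_dist_eq_0[unfolded mar_dist_def])

lemma mspace_Mar [simp]: "mspace Mar = UNIV"
  unfolding Mar_def by (simp add: Metric_space.mspace_metric Metric_space_mar_dist)

lemma mdist_Mar [simp]: "mdist Mar = mar_dist"
  unfolding Mar_def by (simp add: Metric_space.mdist_metric Metric_space_mar_dist)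


section \<open>The Martinet structure as a quotient of the Engel group\<close>

text \<open>The Engel group in coordinates \<open>(x\<^sub>1, x\<^sub>2, y, z)\<close>, and the verification that \<open>(x\<^sub>1, x\<^sub>2, z)\<close> are
  global coordinates on the space of right cosets \<open>\<H> g\<close>, in which the projections of the
  left-invariant fields are \<^const>\<open>mar_X1\<close> and \<^const>\<open>mar_X2\<close>, and Lebesgue measure is invariant.\<close>

type_synonym engel = "real \<times> real \<times> real \<times> real"

definition eng_mult :: "engel \<Rightarrow> engel \<Rightarrow> engel" where
  "eng_mult = (\<lambda>(x1, x2, y, z) (x1', x2', y', z').
     (x1 + x1', x2 + x2', y + y' + x1 * x2', z + z' + x1 * y' + x1\<^sup>2 / 2 * x2'))"

definition eng_X1 :: "engel \<Rightarrow> engel" where "eng_X1 = (\<lambda>(x1, x2, y, z). (1, 0, 0, 0))"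
definition eng_X2 :: "engel \<Rightarrow> engel" where "eng_X2 = (\<lambda>(x1, x2, y, z). (0, 1, x1, x1\<^sup>2 / 2))"
definition eng_Y :: "engel \<Rightarrow> engel" where "eng_Y = (\<lambda>(x1, x2, y, z). (0, 0, 1, x1))"
definition eng_Z :: "engel \<Rightarrow> engel" where "eng_Z = (\<lambda>(x1, x2, y, z). (0, 0, 0, 1))"

lemma eng_group:
  "eng_mult (eng_mult a b) c = eng_mult a (eng_mult b c)"
  "eng_mult 0 a = a" "eng_mult a 0 = a"
  "\<exists>b. eng_mult a b = 0 \<and> eng_mult b a = 0"
proof -
  show "eng_mult (eng_mult a b) c = eng_mult a (eng_mult b c)"
    by (cases a; cases b; cases c) (simp add: eng_mult_def field_simps power2_eq_square)
  show "eng_mult 0 a = a" "eng_mult a 0 = a"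
    by (cases a; simp add: eng_mult_def zero_prod_def)+
  obtain x1 x2 y z where a: "a = (x1, x2, y, z)" by (cases a)
  show "\<exists>b. eng_mult a b = 0 \<and> eng_mult b a = 0"
    by (rule exI[of _ "(- x1, - x2, x1 * x2 - y, x1 * y - x1\<^sup>2 / 2 * x2 - z)"])
       (simp add: a eng_mult_def zero_prod_def algebra_simps power2_eq_square)
qed

text \<open>The differential of a left translation at the identity maps the standard basis to
  \<open>X\<^sub>1, X\<^sub>2, Y, Z\<close>, so these are the left-invariant fields.\<close>

lemma eng_left_invariant:
  "(eng_mult g has_derivative
     (\<lambda>(a, b, c, d). a *\<^sub>R eng_X1 g + b *\<^sub>R eng_X2 g + c *\<^sub>R eng_Y g + d *\<^sub>R eng_Z g)) (at 0)"
proof -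
  obtain x1 x2 y z where g: "g = (x1, x2, y, z)" by (cases g)
  have "((\<lambda>v. (x1 + fst v, x2 + fst (snd v), y + fst (snd (snd v)) + x1 * fst (snd v),
       z + snd (snd (snd v)) + x1 * fst (snd (snd v)) + x1\<^sup>2 / 2 * fst (snd v))) has_derivative
     (\<lambda>v. (fst v, fst (snd v), fst (snd (snd v)) + x1 * fst (snd v),
       snd (snd (snd v)) + x1 * fst (snd (snd v)) + x1\<^sup>2 / 2 * fst (snd v)))) (at (0::engel))"
    by (auto intro!: derivative_eq_intros)
  then show ?thesis
    by (simp add: g eng_mult_def eng_X1_def eng_X2_def eng_Y_def eng_Z_def case_prod_unfold
        algebra_simps)
qed

definition lie_bracket :: "('a::real_normed_vector \<Rightarrow> 'a) \<Rightarrow> ('a \<Rightarrow> 'a) \<Rightarrow> 'a \<Rightarrow> 'a" where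
  "lie_bracket V W p = frechet_derivative W (at p) (V p) - frechet_derivative V (at p) (W p)"

lemma eng_derivatives:
  "frechet_derivative eng_X1 (at p) = (\<lambda>v. 0)"
  "frechet_derivative eng_X2 (at p) = (\<lambda>v. (0, 0, fst v, fst p * fst v))"
  "frechet_derivative eng_Y (at p) = (\<lambda>v. (0, 0, 0, fst v))"
  "frechet_derivative eng_Z (at p) = (\<lambda>v. 0)"
  unfolding eng_X1_def eng_X2_def eng_Y_def eng_Z_def case_prod_unfold
  by (rule frechet_derivative_at[symmetric],
      auto intro!: derivative_eq_intros simp: power2_eq_square)+

lemma eng_brackets:
  "lie_bracket eng_X1 eng_X2 = eng_Y" "lie_bracket eng_X1 eng_Y = eng_Z"
  "lie_bracket eng_X1 eng_Z = (\<lambda>_. 0)" "lie_bracket eng_X2 eng_Y = (\<lambda>_. 0)"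
  "lie_bracket eng_X2 eng_Z = (\<lambda>_. 0)" "lie_bracket eng_Y eng_Z = (\<lambda>_. 0)"
  unfolding fun_eq_iff lie_bracket_def eng_derivatives
  by (auto simp: zero_prod_def eng_X1_def eng_X2_def eng_Y_def eng_Z_def)

definition eng_H :: "engel set" where
  "eng_H = range (\<lambda>s. (0, 0, s, 0))"

lemma eng_H_one_parameter:
  "eng_mult (0, 0, s, 0) (0, 0, t, 0) = (0, 0, s + t, 0)"
  "((\<lambda>s. (0, 0, s, 0)) has_vector_derivative eng_Y (0, 0, s, 0)) (at s)"
  by (auto simp: eng_mult_def eng_Y_def has_vector_derivative_def intro!: derivative_eq_intros)

definition mar_proj :: "engel \<Rightarrow> real \<times> real \<times> real" where
  "mar_proj = (\<lambda>(x1, x2, y, z). (x1, x2, z))"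

lemma surj_mar_proj: "surj mar_proj"
proof (rule surjI)
  show "mar_proj ((\<lambda>(x1, x2, z). (x1, x2, 0, z)) p) = p" for p
    by (simp add: mar_proj_def case_prod_unfold)
qed

lemma mar_proj_eq_iff: "mar_proj g = mar_proj g' \<longleftrightarrow> (\<exists>h \<in> eng_H. g' = eng_mult h g)"
proof -
  obtain x1 x2 y z where g: "g = (x1, x2, y, z)" by (cases g)
  obtain x1' x2' y' z' where g': "g' = (x1', x2', y', z')" by (cases g')
  show ?thesis
    by (auto simp: g g' mar_proj_def eng_H_def eng_mult_def intro: exI[of _ "y' - y"])
qed

lemma mar_proj_pushforward:
  "frechet_derivative mar_proj (at g) (eng_X1 g) = mar_X1 (mar_proj g)"
  "frechet_derivative mar_proj (at g) (eng_X2 g) = mar_X2 (mar_proj g)"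
proof -
  have "(mar_proj has_derivative (\<lambda>v. (fst v, fst (snd v), snd (snd (snd v))))) (at g)"
    unfolding mar_proj_def case_prod_unfold by (auto intro!: derivative_eq_intros)
  from frechet_derivative_at[OF this, symmetric]
  show "frechet_derivative mar_proj (at g) (eng_X1 g) = mar_X1 (mar_proj g)"
    "frechet_derivative mar_proj (at g) (eng_X2 g) = mar_X2 (mar_proj g)"
    by (auto simp: eng_X1_def eng_X2_def mar_X1_def mar_X2_def mar_proj_def split: prod.split)
qed

definition mar_act :: "real \<times> real \<times> real \<Rightarrow> engel \<Rightarrow> real \<times> real \<times> real" where
  "mar_act = (\<lambda>(x1, x2, z) (x1', x2', y', z').
     (x1 + x1', x2 + x2', z + z' + x1 * y' + x1\<^sup>2 / 2 * x2'))"

lemma mar_act_proj: "mar_act (mar_proj g) h = mar_proj (eng_mult g h)"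
  by (cases g; cases h) (simp add: mar_act_def mar_proj_def eng_mult_def)

lemma nn_integral_shift:
  assumes "f \<in> borel_measurable borel"
  shows "(\<integral>\<^sup>+x. f (x + c) \<partial>lborel) = (\<integral>\<^sup>+x. f x \<partial>(lborel :: real measure))"
proof -
  have "(\<integral>\<^sup>+x. f x \<partial>(lborel :: real measure)) = (\<integral>\<^sup>+x. f x \<partial>distr lborel borel ((+) c))"
    by (simp add: lborel_distr_plus)
  also have "\<dots> = (\<integral>\<^sup>+x. f (x + c) \<partial>lborel)"
    using assms by (subst nn_integral_distr) (auto simp: add.commute)
  finally show ?thesis by simp
qed

lemma nn_integral_lborel3:
  fixes f :: "real \<times> real \<times> real \<Rightarrow> ennreal"
  assumes [measurable]: "f \<in> borel_measurable borel"
  shows "(\<integral>\<^sup>+p. f p \<partial>lborel) = (\<integral>\<^sup>+x. \<integral>\<^sup>+y. \<integral>\<^sup>+z. f (x, y, z) \<partial>lborel \<partial>lborel \<partial>lborel)"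
proof -
  have "(\<integral>\<^sup>+p. f p \<partial>lborel) = (\<integral>\<^sup>+x. \<integral>\<^sup>+p. f (x, p) \<partial>lborel \<partial>lborel)"
    by (subst lborel_prod[symmetric], subst lborel.nn_integral_fst[symmetric])
       (simp_all add: lborel_prod)
  also have "\<dots> = (\<integral>\<^sup>+x. \<integral>\<^sup>+y. \<integral>\<^sup>+z. f (x, y, z) \<partial>lborel \<partial>lborel \<partial>lborel)"
  proof (rule nn_integral_cong)
    fix x :: real
    have [measurable]: "(\<lambda>p. f (x, p)) \<in> borel_measurable borel"
      by (intro measurable_compose[OF _ assms] borel_measurable_continuous_onI continuous_intros)
    show "(\<integral>\<^sup>+p. f (x, p) \<partial>lborel) = (\<integral>\<^sup>+y. \<integral>\<^sup>+z. f (x, y, z) \<partial>lborel \<partial>lborel)"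
      by (subst lborel_prod[symmetric], subst lborel.nn_integral_fst[symmetric])
         (simp_all add: lborel_prod)
  qed
  finally show ?thesis .
qed

lemma lborel_mar_act_invariant: "distr lborel borel (\<lambda>p. mar_act p g) = lborel"
proof (rule measure_eqI)
  obtain a b c d where g: "g = (a, b, c, d)" by (cases g)
  have act: "mar_act p g = (fst p + a, fst (snd p) + b,
      snd (snd p) + (d + fst p * c + (fst p)\<^sup>2 / 2 * b))" for p
    by (cases p) (simp add: g mar_act_def)
  have meas [measurable]: "(\<lambda>p. mar_act p g) \<in> borel_measurable borel"
    unfolding act by (intro borel_measurable_continuous_onI continuous_intros) auto
  fix A assume "A \<in> sets (distr lborel borel (\<lambda>p. mar_act p g))"
  then have A [measurable]: "A \<in> sets borel" by simp
  have mA: "(indicator A :: real \<times> real \<times> real \<Rightarrow> ennreal) \<in> borel_measurable borel" by measurable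
  define F where "F = (\<lambda>x y. \<integral>\<^sup>+z. indicator A (x, y, z) \<partial>lborel :: ennreal)"
  have mF: "(\<lambda>(x, y). F x y) \<in> borel_measurable (borel :: (real \<times> real) measure)"
  proof -
    have "(\<lambda>w :: (real \<times> real) \<times> real. (fst (fst w), snd (fst w), snd w)) \<in> borel_measurable borel"
      by (intro borel_measurable_continuous_onI continuous_intros)
    from measurable_compose[OF this mA]
    have "(\<lambda>w :: (real \<times> real) \<times> real. indicator A (fst (fst w), snd (fst w), snd w) :: ennreal)
        \<in> borel_measurable (borel \<Otimes>\<^sub>M lborel)"
      by (simp add: borel_prod[symmetric] cong: measurable_cong_sets)
    then show ?thesis
      unfolding F_def case_prod_unfold
      using lborel.borel_measurable_nn_integral
        [of "\<lambda>p z. indicator A (fst p, snd p, z) :: ennreal" "borel :: (real \<times> real) measure"]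
      by (simp add: case_prod_unfold)
  qed
  have mFx: "(\<lambda>y. F x y) \<in> borel_measurable borel" for x
  proof -
    have "(\<lambda>y :: real. (x, y)) \<in> borel_measurable borel"
      by (intro borel_measurable_continuous_onI continuous_intros)
    from measurable_compose[OF this mF] show ?thesis by simp
  qed
  have mG: "(\<lambda>x. \<integral>\<^sup>+y. F x y \<partial>lborel) \<in> borel_measurable borel"
    by (rule lborel.borel_measurable_nn_integral)
       (use mF in \<open>simp add: borel_prod[symmetric] cong: measurable_cong_sets\<close>)
  have "emeasure (distr lborel borel (\<lambda>p. mar_act p g)) A = (\<integral>\<^sup>+p. indicator A (mar_act p g) \<partial>lborel)"
    by (subst nn_integral_indicator[symmetric], simp, subst nn_integral_distr) (use mA in auto)
  also have "\<dots> = (\<integral>\<^sup>+x. \<integral>\<^sup>+y. \<integral>\<^sup>+z. indicator A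
      (x + a, y + b, z + (d + x * c + x\<^sup>2 / 2 * b)) \<partial>lborel \<partial>lborel \<partial>lborel)"
    by (subst nn_integral_lborel3) (use measurable_compose[OF meas mA] in \<open>auto simp: act\<close>)
  also have "\<dots> = (\<integral>\<^sup>+x. \<integral>\<^sup>+y. F (x + a) (y + b) \<partial>lborel \<partial>lborel)"
  proof (intro nn_integral_cong)
    fix x y :: real
    have "(\<lambda>z :: real. (x + a, y + b, z)) \<in> borel_measurable borel"
      by (intro borel_measurable_continuous_onI continuous_intros)
    from nn_integral_shift[OF measurable_compose[OF this mA]]
    show "(\<integral>\<^sup>+z. indicator A (x + a, y + b, z + (d + x * c + x\<^sup>2 / 2 * b)) \<partial>lborel) = F (x + a) (y + b)"
      by (simp add: F_def)
  qed
  also have "\<dots> = (\<integral>\<^sup>+x. \<integral>\<^sup>+y. F (x + a) y \<partial>lborel \<partial>lborel)"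
    by (simp add: nn_integral_shift[OF mFx])
  also have "\<dots> = (\<integral>\<^sup>+x. \<integral>\<^sup>+y. F x y \<partial>lborel \<partial>lborel)"
    by (rule nn_integral_shift[OF mG])
  also have "\<dots> = (\<integral>\<^sup>+p. indicator A p \<partial>lborel)"
    unfolding F_def by (rule nn_integral_lborel3[OF mA, symmetric])
  also have "\<dots> = emeasure lborel A" by simp
  finally show "emeasure (distr lborel borel (\<lambda>p. mar_act p g)) A = emeasure lborel A" .
qed simp

end

theory Submission
  imports Defs
begin

text \<open>Write points as \<open>(x, y, z)\<close>. The line \<open>x = z = 0\<close> is an abnormal minimiser through the
  origin, and the property fails because geodesics from the origin to nearby points leave this
  line late and at an exponential rate.

  By \<open>MCP_midpoints_measure\<close>, the property at time \<open>1/2\<close> gives a constant \<open>k > 0\<close> such that,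
  for compact \<open>A\<close> of positive measure in the ball of radius 2 about the origin, every Borel set
  \<open>B\<close> that contains the midpoints between the points of \<open>A\<close> and the origin has measure at least \<open>k\<close> times that of \<open>A\<close>. Let \<open>A\<close>
  consist of points \<open>p = (a, y, z)\<close> with \<open>a\<close> of order \<open>\<epsilon>\<close>, \<open>y\<close> of order 1 and \<open>z\<close> of order \<open>\<epsilon>\<^sup>2 / n\<close>,
  where \<open>\<epsilon>\<close> is very small compared with \<open>1 / n\<close>. To first approximation, a curve from the origin
  to \<open>p\<close> is a graph over the \<open>y\<close>-axis of length \<open>y + \<integral>x'\<^sup>2/2\<close>, subject to \<open>\<integral>x\<^sup>2/2 = z\<close>. The
  minimisers of this quadratic problem grow like \<open>exp (\<kappa> y)\<close> with \<open>\<kappa>\<close> of order \<open>n\<close>. Half way, such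
  a curve is still so close to the line that its third coordinate is at most of order \<open>\<epsilon>\<^sup>2 / n\<^sup>2\<close>
  (in truth exponentially small, but this is enough). So the volume of \<open>B\<close> is at most of order
  \<open>1 / n\<close> times that of \<open>A\<close>, which is impossible for large \<open>n\<close>.

  No geodesic is computed. A midpoint \<open>q\<close> is located by comparing two bounds for the distance from
  the origin to \<open>p\<close> that differ by \<open>O(a\<^sup>2)\<close> only, although \<open>\<kappa> a\<^sup>2\<close> is the order of the excess of the
  distance over \<open>y\<close>. The upper bound, \<open>mar_dist_origin_le\<close>, is the length of an explicit curve,
  a monomial of high degree that stands in for the exponential. The lower bound comes from
  calibrations: a function whose horizontal gradient has norm at most 1 along a curve grows by at
  most the length of the curve (\<open>calibration_le_length\<close>). The calibrations used are
  \<open>y - c z + \<phi>(y) x\<^sup>2/2\<close> with affine \<open>\<phi>\<close>, one before \<open>q\<close> and one after \<open>q\<close>. The mismatch of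
  their coefficients at \<open>q\<close> leaves a multiple of \<open>z\<close> at \<open>q\<close>, which therefore has to be as small as the gap
  between the two bounds; this is \<open>midpoint_estimate\<close>.

  Compact boxes are admissible sets \<open>A\<close> because the Martinet distance induces the Euclidean
  topology (\<open>openin_Mar_iff_open\<close>).\<close>

section \<open>Borel sets, uniform measures and geodesics of metric spaces\<close>

lemma openin_mtopology_of_subset: "openin (mtopology_of X) U \<Longrightarrow> U \<subseteq> mspace X"
  using openin_subset by fastforce

lemma Pow_openin_mtopology_of: "{U. openin (mtopology_of X) U} \<subseteq> Pow (mspace X)"
  using openin_mtopology_of_subset by blast

lemma space_mborel [simp]: "space (mborel X) = mspace X"
  unfolding mborel_def by (rule space_measure_of[OF Pow_openin_mtopology_of])

lemma sets_mborel: "sets (mborel X) = sigma_sets (mspace X) {U. openin (mtopology_of X) U}"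
  unfolding mborel_def by (rule sets_measure_of[OF Pow_openin_mtopology_of])

lemma openin_sets_mborel: "openin (mtopology_of X) U \<Longrightarrow> U \<in> sets (mborel X)"
  unfolding sets_mborel by (rule sigma_sets.Basic) simp

lemma closedin_sets_mborel:
  assumes "closedin (mtopology_of X) C"
  shows "C \<in> sets (mborel X)"
proof -
  have "mspace X - (mspace X - C) \<in> sets (mborel X)"
    using sets.compl_sets[OF openin_sets_mborel[of X "mspace X - C"]] assms
    by (simp add: closedin_def)
  moreover have "C \<subseteq> mspace X"
    using closedin_subset[OF assms] by simp
  ultimately show ?thesis
    by (simp add: double_diff)
qed

lemma singleton_sets_mborel:
  assumes "x \<in> mspace X"
  shows "{x} \<in> sets (mborel X)"
proof -
  interpret Metric_space "mspace X" "mdist X" by simp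
  have "closedin (mtopology_of X) {x}"
    unfolding mtopology_of_def using assms Hausdorff_space_mtopology
    by (simp add: closedin_Hausdorff_sing_eq)
  then show ?thesis
    by (rule closedin_sets_mborel)
qed

lemma measurable_mborel_continuous_map:
  assumes "continuous_map (mtopology_of X) (mtopology_of Y) f"
  shows "f \<in> measurable (mborel X) (mborel Y)"
proof (rule measurable_sigma_sets[OF sets_mborel Pow_openin_mtopology_of])
  show "f \<in> space (mborel X) \<rightarrow> mspace Y"
    using assms by (auto simp: continuous_map_def)
  fix U assume "U \<in> {U. openin (mtopology_of Y) U}"
  then have "openin (mtopology_of X) {x \<in> topspace (mtopology_of X). f x \<in> U}"
    using assms by (intro openin_continuous_map_preimage) auto
  then show "f -` U \<inter> space (mborel X) \<in> sets (mborel X)"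
    by (auto intro!: openin_sets_mborel simp: vimage_def Int_def conj_commute)
qed

lemma mborel_euclidean_metric: "sets (mborel euclidean_metric) = sets borel"
  unfolding mborel_def borel_def by (simp add: open_openin)

text \<open>The distance of \<open>Geo X\<close> is the uniform one, so evaluation at a time is 1-Lipschitz and in
  particular Borel.\<close>

lemma Lipschitz_continuous_map_eval:
  assumes "t \<in> {0..1}"
  shows "Lipschitz_continuous_map (Geo X) X (\<lambda>\<gamma>. \<gamma> t)"
  unfolding Lipschitz_continuous_map_def
proof (intro conjI exI[of _ 1] ballI)
  show "(\<lambda>\<gamma>. \<gamma> t) \<in> mspace (Geo X) \<rightarrow> mspace X"
    using assms by (auto simp: Geo_def)
  fix \<gamma> \<eta> assume "\<gamma> \<in> mspace (Geo X)" "\<eta> \<in> mspace (Geo X)"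
  then have "\<gamma> \<in> mspace (cfunspace (top_of_set {0..1}) X)" "\<eta> \<in> mspace (cfunspace (top_of_set {0..1}) X)"
    unfolding Geo_def by (simp_all only: mspace_submetric Int_iff)
  from iffD1[OF cfunspace_mdist_le[OF this, of "mdist (Geo X) \<gamma> \<eta>"]] assms
  show "mdist X (\<gamma> t) (\<eta> t) \<le> 1 * mdist (Geo X) \<gamma> \<eta>"
    by (auto simp: Geo_def)
qed

lemma measurable_eval:
  assumes "t \<in> {0..1}"
  shows "(\<lambda>\<gamma>. \<gamma> t) \<in> measurable (mborel (Geo X)) (mborel X)"
  by (intro measurable_mborel_continuous_map Lipschitz_continuous_imp_continuous_map
      Lipschitz_continuous_map_eval assms)

lemma measurable_geodesic_length:
  "(\<lambda>\<gamma>. mdist X (\<gamma> 0) (\<gamma> 1)) \<in> borel_measurable (mborel (Geo X))"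
proof -
  have "(\<lambda>\<gamma>. mdist X (\<gamma> 0) (\<gamma> 1)) \<in> measurable (mborel (Geo X)) (mborel euclidean_metric)"
    by (intro measurable_mborel_continuous_map Lipschitz_continuous_imp_continuous_map
        Lipschitz_continuous_map_mdist[where m' = X] Lipschitz_continuous_map_eval) auto
  then show ?thesis
    by (simp add: measurable_cong_sets[OF refl mborel_euclidean_metric])
qed

text \<open>The support is closed and cannot leave a closed set of full measure, so it inherits
  compactness from \<open>A\<close>.\<close>

lemma uniform_measure_in_Pc:
  fixes m :: "'a measure"
  assumes "sets m = sets (mborel X)" "compactin (mtopology_of X) A" "closedin (mtopology_of X) A"
    "0 < emeasure m A" "emeasure m A < \<infinity>"
  shows "uniform_measure m A \<in> Pc X"
proof -
  define S where "S = msupport X (uniform_measure m A)"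
  have A: "A \<in> sets m" using closedin_sets_mborel[OF assms(3)] assms(1) by simp
  have ps: "prob_space (uniform_measure m A)"
    using assms by (intro prob_space_uniform_measure) auto
  have opn: "openin (mtopology_of X) (mspace X - S)"
  proof (subst openin_subopen, intro ballI)
    fix x assume x: "x \<in> mspace X - S"
    then obtain U where U: "openin (mtopology_of X) U" "x \<in> U" "emeasure (uniform_measure m A) U = 0"
      unfolding S_def msupport_def by (auto simp: zero_less_iff_neq_zero)
    then have "U \<subseteq> mspace X - S"
      using openin_mtopology_of_subset[OF U(1)] by (auto simp: S_def msupport_def zero_less_iff_neq_zero)
    with U show "\<exists>T. openin (mtopology_of X) T \<and> x \<in> T \<and> T \<subseteq> mspace X - S" by blast
  qed
  have "S \<subseteq> mspace X" by (auto simp: S_def msupport_def)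
  with opn have cl: "closedin (mtopology_of X) S" by (simp add: closedin_def)
  have "x \<in> A" if "x \<in> S" for x
  proof (rule ccontr)
    assume "x \<notin> A"
    have O: "openin (mtopology_of X) (mspace X - A)" using assms(3) by (simp add: closedin_def)
    have "emeasure (uniform_measure m A) (mspace X - A) = 0"
      using openin_sets_mborel[OF O] assms(1) A
      by (subst emeasure_uniform_measure) (auto simp: Int_Diff)
    moreover have "0 < emeasure (uniform_measure m A) (mspace X - A)"
      using that O \<open>x \<notin> A\<close> unfolding S_def msupport_def by blast
    ultimately show False by simp
  qed
  then have "compactin (mtopology_of X) S"
    by (intro closed_compactin[OF assms(2) _ cl]) auto
  then show ?thesis
    using ps assms(1) by (simp add: Pc_def S_def)
qed


section \<open>Midpoint sets under the measure contraction property\<close>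

lemma measurable_ennreal_powr [measurable (raw)]:
  assumes [measurable]: "f \<in> borel_measurable M"
  shows "(\<lambda>x. ennreal_powr (f x) a) \<in> borel_measurable M"
  unfolding ennreal_powr_def by measurable

lemma measurable_tau: "tau K N t \<in> borel_measurable borel"
  unfolding tau_def[abs_def] sinh_field_def by measurable

text \<open>At time \<open>1/2\<close> the duplication formulas give \<open>sin w / sin (2 w) = 1 / (2 cos w) \<ge> 1/2\<close> and
  \<open>sinh w / sinh (2 w) = 1 / (2 cosh w)\<close>, while the flat value is \<open>1/2\<close>. The hyperbolic
  case is the worst, and as \<open>cosh\<close> is increasing, its bound at the largest distance serves for all.\<close>

lemma tau_half_bound:
  fixes K N D \<theta> :: real
  assumes N: "1 \<le> N" and \<theta>: "0 \<le> \<theta>" "\<theta> \<le> D"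
  shows "ennreal (1 / (2 * cosh (D * sqrt (\<bar>K\<bar> / (N - 1))))) \<le> tau K N (1/2) \<theta>"
proof -
  define b where "b = 1 / (2 * cosh (D * sqrt (\<bar>K\<bar> / (N - 1))))"
  have b0: "0 < b" by (simp add: b_def)
  have b1: "b \<le> 1/2" unfolding b_def using cosh_real_ge_1[of "D * sqrt (\<bar>K\<bar> / (N - 1))"] 
    by (simp add: divide_simps)
  have *: "b \<le> (1/2) powr (1/N) * c powr (1 - 1/N)" if "b \<le> c" for c
  proof -
    have "b = b powr (1/N) * b powr (1 - 1/N)"
      using b0 by (simp add: powr_add[symmetric])
    also have "\<dots> \<le> (1/2) powr (1/N) * c powr (1 - 1/N)"
      using b0 b1 that N by (intro mult_mono powr_mono2) auto
    finally show ?thesis .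
  qed
  show ?thesis
    unfolding b_def[symmetric] tau_def
  proof (split if_split, intro conjI impI, simp, split if_split, intro conjI impI, goal_cases)
    case 1
    define w where "w = \<theta> * sqrt (K / (N - 1)) / 2"
    have K: "0 < K" "\<theta> \<noteq> 0" using 1 by (auto simp: zero_less_mult_iff)
    have lt: "K * \<theta>\<^sup>2 < (N - 1) * pi\<^sup>2" using 1 K by auto
    moreover have "0 < K * \<theta>\<^sup>2" using 1 by simp
    ultimately have "0 < (N - 1) * pi\<^sup>2" by linarith
    then have N1: "1 < N" by (auto simp: zero_less_mult_iff)
    have "K / (N - 1) * \<theta>\<^sup>2 < pi\<^sup>2" using lt N1 by (simp add: field_simps)
    then have "sqrt (K / (N - 1)) * \<theta> < pi"
      using \<theta> by (metis pi_ge_zero real_sqrt_abs real_sqrt_less_iff real_sqrt_mult abs_of_nonneg)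
    then have w: "0 < w" "w < pi/2"
      using K N1 \<theta> by (auto simp: w_def mult.commute)
    have s: "0 < sin w" "0 < cos w" using w by (auto intro!: sin_gt_zero cos_gt_zero)
    have "sin w / sin (2 * w) = 1 / (2 * cos w)"
      unfolding sin_double using s by (simp add: divide_simps)
    moreover have "1 / 2 \<le> 1 / (2 * cos w)" using s cos_le_one[of w] by (simp add: field_simps)
    ultimately have "b \<le> sin w / sin (2 * w)" using b1 by linarith
    from *[OF this] show ?case
      by (intro ennreal_leI) (simp add: w_def)
  next
    case 2
    show ?case
    proof (split if_split, intro conjI impI, goal_cases)
      case 1
      then show ?case using b1 by (intro ennreal_leI) simp
    next
      case 2
      define w where "w = \<theta> * sqrt (\<bar>K\<bar> / (N - 1)) / 2"
      have N1: "1 < N" and K: "K < 0" "0 < \<theta>"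
        using 2 \<open>\<not> 0 < K * \<theta>\<^sup>2\<close> N \<theta> by (auto simp: zero_less_mult_iff not_less le_less)
      have "0 < sqrt (\<bar>K\<bar> / (N - 1))" using K N1 by (simp add: divide_neg_pos)
      then have w: "0 < w" using K by (simp add: w_def)
      have le: "w \<le> D * sqrt (\<bar>K\<bar> / (N - 1))"
      proof -
        have "w \<le> \<theta> * sqrt (\<bar>K\<bar> / (N - 1))" using w by (simp add: w_def)
        also have "\<dots> \<le> D * sqrt (\<bar>K\<bar> / (N - 1))"
          using \<theta> N1 by (intro mult_right_mono) auto
        finally show ?thesis .
      qed
      have "cosh w \<le> cosh (D * sqrt (\<bar>K\<bar> / (N - 1)))"
        using le w by (subst cosh_real_nonneg_le_iff) auto
      then have "b \<le> 1 / (2 * cosh w)"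
        unfolding b_def by (simp add: divide_simps)
      also have "\<dots> = sinh w / sinh (2 * w)"
        unfolding sinh_double using w by (simp add: divide_simps)
      finally have "b \<le> sinh w / sinh (2 * w)" .
      from *[OF this] show ?case
        by (intro ennreal_leI) (simp add: w_def)
    qed
  qed
qed

text \<open>A Brunn--Minkowski inequality for midpoints. Almost every geodesic of the transport starts in
  \<open>A\<close> and ends in \<open>x0\<close>, hence is in \<open>B\<close> at time \<open>1/2\<close>, so \<open>B\<close> receives the whole mass,
  weighted by a coefficient that \<open>tau_half_bound\<close> bounds below. The point of the
  formulation is that \<open>c\<close> is chosen before \<open>x0\<close>, \<open>A\<close> and \<open>B\<close>.\<close>

lemma MCP_midpoints_measure:
  fixes X :: "'a metric" and K N D :: real
  assumes "1 \<le> N" and "MCP X m K N" and sm: "sets m = sets (mborel X)"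
  obtains c where "0 < c"
    and "\<And>x0 A B. \<lbrakk>x0 \<in> mspace X; A \<in> sets m; B \<in> sets m; 0 < emeasure m A; emeasure m A < \<infinity>;
        uniform_measure m A \<in> Pc X; \<And>p. p \<in> A \<Longrightarrow> mdist X p x0 \<le> D;
        \<And>p q. \<lbrakk>p \<in> A; q \<in> mspace X; mdist X p q = mdist X p x0 / 2; mdist X q x0 = mdist X p x0 / 2\<rbrakk>
          \<Longrightarrow> q \<in> B\<rbrakk>
      \<Longrightarrow> ennreal c * emeasure m A \<le> emeasure m B"
proof -
  define b where "b = 1 / (2 * cosh (D * sqrt (\<bar>K\<bar> / (N - 1))))"
  have b0: "0 < b" by (simp add: b_def)
  have pos: "0 < b powr N" using b0 by simp
  show ?thesis
  proof (rule that[OF pos])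
    fix x0 A B
    assume x0: "x0 \<in> mspace X" and A: "A \<in> sets m" and B: "B \<in> sets m"
      and A0: "0 < emeasure m A" "emeasure m A < \<infinity>" and Pc: "uniform_measure m A \<in> Pc X"
      and D: "\<And>p. p \<in> A \<Longrightarrow> mdist X p x0 \<le> D"
      and mid: "\<And>p q. \<lbrakk>p \<in> A; q \<in> mspace X; mdist X p q = mdist X p x0 / 2;
          mdist X q x0 = mdist X p x0 / 2\<rbrakk> \<Longrightarrow> q \<in> B"
    define f where "f = (\<lambda>\<gamma> :: real \<Rightarrow> 'a. ennreal_powr (tau K N (1/2) (mdist X (\<gamma> 0) (\<gamma> 1))) N)"
    have "\<exists>\<nu> \<in> OptGeo X (uniform_measure m A) (return (mborel X) x0).
        \<forall>t \<in> {0..1}. \<forall>B \<in> sets (mborel X).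
          emeasure
            (distr (density \<nu> (\<lambda>\<gamma>. ennreal_powr (tau K N (1 - t) (mdist X (\<gamma> 0) (\<gamma> 1))) N))
               (mborel X) (\<lambda>\<gamma>. \<gamma> t)) B
          \<le> emeasure m B / emeasure m A"
      by (rule bspec[OF bspec[OF assms(2)[unfolded MCP_def] x0], of A, THEN mp])
         (use A A0 Pc in \<open>simp_all add: sm\<close>)
    then obtain \<nu> where \<nu>: "\<nu> \<in> OptGeo X (uniform_measure m A) (return (mborel X) x0)"
      and contr: "\<And>t B. \<lbrakk>t \<in> {0..1}; B \<in> sets (mborel X)\<rbrakk> \<Longrightarrow>
          emeasure
            (distr (density \<nu> (\<lambda>\<gamma>. ennreal_powr (tau K N (1 - t) (mdist X (\<gamma> 0) (\<gamma> 1))) N))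
               (mborel X) (\<lambda>\<gamma>. \<gamma> t)) B
          \<le> emeasure m B / emeasure m A"
      by blast
    from contr[of "1/2" B] B
    have le: "emeasure (distr (density \<nu> f) (mborel X) (\<lambda>\<gamma>. \<gamma> (1/2))) B \<le> emeasure m B / emeasure m A"
      by (simp add: f_def sm)
    have s\<nu>: "sets \<nu> = sets (mborel (Geo X))" and "prob_space \<nu>"
      and cp: "distr \<nu> (mborel X \<Otimes>\<^sub>M mborel X) (\<lambda>\<gamma>. (\<gamma> 0, \<gamma> 1))
        \<in> couplings X (uniform_measure m A) (return (mborel X) x0)"
      using \<nu> by (auto simp: OptGeo_def optimal_couplings_def)
    interpret prob_space \<nu> by fact
    have sp: "space \<nu> = mspace (Geo X)"
      using sets_eq_imp_space_eq[OF s\<nu>] by simp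
    have ev [measurable]: "(\<lambda>\<gamma>. \<gamma> t) \<in> measurable \<nu> (mborel X)" if "t \<in> {0..1}" for t
      using measurable_eval[OF that, of X] by (simp add: measurable_cong_sets[OF s\<nu> refl])
    have [measurable]: "(\<lambda>\<gamma>. mdist X (\<gamma> 0) (\<gamma> 1)) \<in> borel_measurable \<nu>"
      using measurable_geodesic_length[of X] by (simp add: measurable_cong_sets[OF s\<nu> refl])
    note measurable_tau[measurable]
    have [measurable]: "f \<in> borel_measurable \<nu>"
      unfolding f_def by measurable
    have marg: "distr \<nu> (mborel X) (\<lambda>\<gamma>. \<gamma> 0) = uniform_measure m A"
      "distr \<nu> (mborel X) (\<lambda>\<gamma>. \<gamma> 1) = return (mborel X) x0"
      using cp ev[of 0] ev[of 1] by (auto simp: couplings_def distr_distr o_def)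
    have 0: "AE \<gamma> in \<nu>. \<gamma> 0 \<in> A"
    proof -
      have "AE p in uniform_measure m A. p \<in> A"
        using A A0 by (intro AE_uniform_measureI) auto
      moreover have "{x \<in> space (mborel X). x \<in> A} = A"
        using sets.sets_into_space[of A "mborel X"] A by (auto simp: sm)
      ultimately show ?thesis
        unfolding marg(1)[symmetric] using A ev[of 0]
        by (subst (asm) AE_distr_iff) (auto simp: sm)
    qed
    have 1: "AE \<gamma> in \<nu>. \<gamma> 1 = x0"
    proof -
      have s: "{x \<in> space (mborel X). x = x0} = {x0}" using x0 by auto
      have m1: "{x \<in> space (mborel X). x = x0} \<in> sets (mborel X)"
        unfolding s by (rule singleton_sets_mborel[OF x0])
      have "AE p in return (mborel X) x0. p = x0"
        using x0 m1 by (subst AE_return) (auto simp: pred_def)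
      then show ?thesis
        unfolding marg(2)[symmetric] using ev[of 1] m1
        by (subst (asm) AE_distr_iff) auto
    qed
    have bound: "ennreal (b powr N) \<le> f \<gamma> * indicator B (\<gamma> (1/2))"
      if g: "\<gamma> \<in> space \<nu>" "\<gamma> 0 \<in> A" "\<gamma> 1 = x0" for \<gamma>
    proof -
      have geo: "mdist X (\<gamma> s) (\<gamma> t) = \<bar>s - t\<bar> * mdist X (\<gamma> 0) (\<gamma> 1)" if "s \<in> {0..1}" "t \<in> {0..1}" for s t
      proof -
        have "\<gamma> \<in> {\<gamma>. \<forall>s\<in>{0..1}. \<forall>t\<in>{0..1}. mdist X (\<gamma> s) (\<gamma> t) = \<bar>s - t\<bar> * mdist X (\<gamma> 0) (\<gamma> 1)}"
          using g(1) unfolding sp Geo_def mspace_submetric by blast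
        with that show ?thesis by blast
      qed
      have X: "\<gamma> (1/2) \<in> mspace X"
        using measurable_space[OF ev[of "1/2"] g(1)] by simp
      have "\<gamma> (1/2) \<in> B"
        by (rule mid[OF g(2) X]) (use geo[of 0 "1/2"] geo[of "1/2" 1] g(3) in auto)
      moreover have "ennreal (b powr N) \<le> f \<gamma>"
      proof -
        have *: "ennreal b \<le> tau K N (1/2) (mdist X (\<gamma> 0) (\<gamma> 1))"
          unfolding b_def by (rule tau_half_bound) (use assms(1) g D in auto)
        show ?thesis
        proof (cases "tau K N (1/2) (mdist X (\<gamma> 0) (\<gamma> 1))")
          case (real r)
          then show ?thesis using * b0 assms(1) unfolding f_def ennreal_powr_def
            by (auto intro!: powr_mono2 ennreal_leI)
        qed (simp add: f_def ennreal_powr_def)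
      qed
      ultimately show ?thesis by simp
    qed
    have "AE \<gamma> in \<nu>. ennreal (b powr N) \<le> f \<gamma> * indicator B (\<gamma> (1/2))"
      using AE_space 0 1 by eventually_elim (rule bound)
    then have "(\<integral>\<^sup>+\<gamma>. ennreal (b powr N) \<partial>\<nu>) \<le> (\<integral>\<^sup>+\<gamma>. f \<gamma> * indicator B (\<gamma> (1/2)) \<partial>\<nu>)"
      by (rule nn_integral_mono_AE)
    also have "\<dots> = (\<integral>\<^sup>+\<gamma>. f \<gamma> * indicator ((\<lambda>\<gamma>. \<gamma> (1/2)) -` B \<inter> space \<nu>) \<gamma> \<partial>\<nu>)"
      by (intro nn_integral_cong) (auto split: split_indicator)
    also have "\<dots> = emeasure (density \<nu> f) ((\<lambda>\<gamma>. \<gamma> (1/2)) -` B \<inter> space \<nu>)"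
      using measurable_sets[OF ev[of "1/2"], of B] B by (subst emeasure_density) (auto simp: sm)
    also have "\<dots> = emeasure (distr (density \<nu> f) (mborel X) (\<lambda>\<gamma>. \<gamma> (1/2))) B"
      using B ev[of "1/2"] by (subst emeasure_distr) (auto simp: sm)
    also note le
    finally have "ennreal (b powr N) \<le> emeasure m B / emeasure m A"
      by (simp add: emeasure_space_1)
    then have "ennreal (b powr N) * emeasure m A \<le> emeasure m B / emeasure m A * emeasure m A"
      by (rule mult_right_mono) simp
    also have "\<dots> = emeasure m B"
      using A0 by (simp add: ennreal_divide_times ennreal_mult_divide_eq)
    finally show "ennreal (b powr N) * emeasure m A \<le> emeasure m B" .
  qed
qed


section \<open>Calibrations of horizontal curves\<close>

lemma horizontal_velocity_integral:
  assumes h: "horizontal X1 X2 u \<gamma>" and ab: "0 \<le> a" "a \<le> b" "b \<le> 1"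
  shows "(velocity X1 X2 u \<gamma> has_integral \<gamma> b - \<gamma> a) {a..b}"
proof -
  have 1: "(velocity X1 X2 u \<gamma> has_integral \<gamma> t - \<gamma> 0) {0..t}" if "t \<in> {0..1}" for t
    using h that by (auto simp: horizontal_def)
  have "velocity X1 X2 u \<gamma> integrable_on {a..b}"
    by (rule integrable_subinterval_real[of _ 0 1]) (use 1[of 1] ab in \<open>auto simp: integrable_on_def\<close>)
  then obtain i where i: "(velocity X1 X2 u \<gamma> has_integral i) {a..b}"
    by (auto simp: integrable_on_def)
  have "(velocity X1 X2 u \<gamma> has_integral (\<gamma> a - \<gamma> 0) + i) {0..b}"
    by (rule has_integral_combine[OF _ _ 1 i]) (use ab in auto)
  then have "i = \<gamma> b - \<gamma> a"
    using has_integral_unique[OF 1[of b]] ab by force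
  with i show ?thesis by simp
qed

lemma horizontal_continuous:
  assumes "horizontal X1 X2 u \<gamma>"
  shows "continuous_on {0..1} \<gamma>"
proof -
  have I: "(velocity X1 X2 u \<gamma> has_integral \<gamma> t - \<gamma> 0) {0..t}" if "t \<in> {0..1}" for t
    using assms that by (auto simp: horizontal_def)
  have "continuous_on {0..1} (\<lambda>t. \<gamma> 0 + integral {0..t} (velocity X1 X2 u \<gamma>))"
    using I[of 1] by (intro continuous_intros indefinite_integral_continuous_1) (auto simp: integrable_on_def)
  then show ?thesis
    by (rule continuous_on_eq) (simp add: integral_unique[OF I])
qed

text \<open>The hypothesis says that the horizontal gradient of \<open>S\<close> has norm at most 1 along the curve, so
  that \<open>S\<close> grows at most at unit speed. Controls are only integrable, so the chain rule for \<open>S\<close>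
  along \<open>\<gamma>\<close> is avoided: differentiability of \<open>S\<close> at one point of the curve gives the inequality,
  with a factor \<open>1 + e\<close>, on all short intervals around that point, and bisection of \<open>{0..1}\<close> glues
  these local inequalities together.\<close>

lemma calibration_le_length:
  fixes X1 X2 :: "'a::euclidean_space \<Rightarrow> 'a" and S :: "'a \<Rightarrow> real"
  assumes h: "horizontal X1 X2 u \<gamma>"
    and cont: "continuous_on UNIV X1" "continuous_on UNIV X2"
    and der: "\<And>s. s \<in> {0..1} \<Longrightarrow> (S has_derivative S' s) (at (\<gamma> s))"
    and eik: "\<And>s. s \<in> {0..1} \<Longrightarrow> (S' s (X1 (\<gamma> s)))\<^sup>2 + (S' s (X2 (\<gamma> s)))\<^sup>2 \<le> 1"
  shows "S (\<gamma> 1) - S (\<gamma> 0) \<le> integral {0..1} (\<lambda>s. norm (u s))"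
proof -
  define len where "len = (\<lambda>a b. integral {a..b} (\<lambda>s. norm (u s)))"
  have un: "(\<lambda>s. norm (u s)) integrable_on {0..1}"
    using h by (auto simp: horizontal_def absolutely_integrable_on_def)
  have int: "(\<lambda>s. norm (u s)) integrable_on {a..b}" if "0 \<le> a" "b \<le> 1" for a b
    by (rule integrable_subinterval_real[OF un]) (use that in auto)
  have len0: "0 \<le> len a b" if "0 \<le> a" "b \<le> 1" for a b
    unfolding len_def by (rule integral_nonneg[OF int[OF that]]) auto
  have len_add: "len a b + len b c = len a c" if "0 \<le> a" "a \<le> b" "b \<le> c" "c \<le> 1" for a b c
    unfolding len_def using that int by (intro Henstock_Kurzweil_Integration.integral_combine) auto
  note c\<gamma> = horizontal_continuous[OF h]
  have cX: "continuous_on {0..1} (\<lambda>s. X1 (\<gamma> s))" "continuous_on {0..1} (\<lambda>s. X2 (\<gamma> s))"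
    by (rule continuous_on_compose2[OF cont(1) c\<gamma>], simp)
       (rule continuous_on_compose2[OF cont(2) c\<gamma>], simp)
  have near_le: "\<exists>d>0. \<forall>s\<in>{0..1}. \<bar>s - x\<bar> < d \<longrightarrow> f s \<le> r"
    if f: "continuous_on {0..1} f" "x \<in> {0..1}" "f x < r" for f :: "real \<Rightarrow> real" and x r
  proof -
    obtain d where "0 < d" "\<forall>s\<in>{0..1}. dist s x < d \<longrightarrow> dist (f s) (f x) < r - f x"
      using f(1)[unfolded continuous_on_iff, rule_format, OF f(2), of "r - f x"] f(3) by auto
    then show ?thesis
      by (intro exI[of _ d]) (fastforce simp: dist_real_def)
  qed
  have key: "S (\<gamma> 1) - S (\<gamma> 0) \<le> (1 + e) * len 0 1" if e: "0 < e" for e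
  proof -
    have "(0::real) \<le> 1" by simp
    then have "0 \<le> (0::real) \<longrightarrow> 1 \<le> (1::real) \<longrightarrow> S (\<gamma> 1) - S (\<gamma> 0) \<le> (1 + e) * len 0 1"
    proof (induction rule: Bolzano[where P = "\<lambda>a b. 0 \<le> a \<longrightarrow> b \<le> 1 \<longrightarrow> S (\<gamma> b) - S (\<gamma> a) \<le> (1 + e) * len a b"])
      case (trans a b c)
      show ?case
      proof (intro impI)
        assume "0 \<le> a" "c \<le> 1"
        then have "S (\<gamma> c) - S (\<gamma> a) \<le> (1 + e) * (len a b + len b c)"
          using trans by (auto simp: algebra_simps)
        then show "S (\<gamma> c) - S (\<gamma> a) \<le> (1 + e) * len a c"
          using len_add[of a b c] trans \<open>0 \<le> a\<close> \<open>c \<le> 1\<close> by simp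
      qed
    next
      case (local x)
      then have x: "x \<in> {0..1}" by auto
      define M where "M = norm (X1 (\<gamma> x)) + norm (X2 (\<gamma> x)) + 1"
      have M: "0 < M" unfolding M_def by (smt (verit) norm_ge_zero)
      define D where "D = S' x"
      have bl: "bounded_linear D" unfolding D_def by (rule has_derivative_bounded_linear[OF der[OF x]])
      have e1: "0 < e / (2 * M)" using e M by simp
      obtain d1 where d1: "0 < d1"
        "\<And>q. norm (q - \<gamma> x) < d1 \<Longrightarrow> \<bar>S q - S (\<gamma> x) - D (q - \<gamma> x)\<bar> \<le> e / (2 * M) * norm (q - \<gamma> x)"
        using der[OF x] e1 unfolding has_derivative_at_alt D_def real_norm_def by metis
      obtain d2 where d2: "0 < d2"
        "\<And>s. s \<in> {0..1} \<Longrightarrow> \<bar>s - x\<bar> < d2 \<Longrightarrow> norm (\<gamma> s - \<gamma> x) < d1"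
        using c\<gamma> x d1(1) unfolding continuous_on_iff dist_norm by (metis real_norm_def)
      have "continuous_on {0..1} (\<lambda>s. norm (X1 (\<gamma> s)) + norm (X2 (\<gamma> s)))"
        by (intro continuous_intros cX)
      from near_le[OF this x, of M]
      obtain d3 where d3: "0 < d3"
        "\<And>s. s \<in> {0..1} \<Longrightarrow> \<bar>s - x\<bar> < d3 \<Longrightarrow> norm (X1 (\<gamma> s)) + norm (X2 (\<gamma> s)) \<le> M"
        unfolding M_def by auto
      have "continuous_on {0..1} (\<lambda>s. norm (D (X1 (\<gamma> s)), D (X2 (\<gamma> s))))"
        by (intro continuous_intros bounded_linear.continuous_on[OF bl] cX)
      note near_le[OF this x, of "1 + e / 2"]
      moreover have "norm (D (X1 (\<gamma> x)), D (X2 (\<gamma> x))) < 1 + e / 2"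
      proof -
        have "norm (D (X1 (\<gamma> x)), D (X2 (\<gamma> x))) \<le> 1"
          using eik[OF x] by (simp add: norm_Pair D_def)
        then show ?thesis using e by simp
      qed
      ultimately obtain d4 where d4: "0 < d4"
        "\<And>s. s \<in> {0..1} \<Longrightarrow> \<bar>s - x\<bar> < d4 \<Longrightarrow> norm (D (X1 (\<gamma> s)), D (X2 (\<gamma> s))) \<le> 1 + e / 2"
        by auto
      \<comment> \<open>Differentiability of \<open>S\<close> costs \<open>e / 2\<close>, because \<open>M\<close> bounds the speed of the curve per unit of
        length; the variation of the fields costs the other half.\<close>
      define d where "d = Min {d2, d3, d4}"
      have d: "0 < d" "d \<le> d2" "d \<le> d3" "d \<le> d4" using d2 d3 d4 by (auto simp: d_def)
      have incr: "norm (\<gamma> b - \<gamma> a) \<le> M * len a b"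
        if "0 \<le> a" "a \<le> b" "b \<le> 1" and near: "\<And>s. s \<in> {a..b} \<Longrightarrow> \<bar>s - x\<bar> < d" for a b
      proof -
        have I: "(velocity X1 X2 u \<gamma> has_integral \<gamma> b - \<gamma> a) {a..b}"
          by (rule horizontal_velocity_integral[OF h that(1-3)])
        have "norm (\<gamma> b - \<gamma> a) \<le> integral {a..b} (\<lambda>s. M * norm (u s))"
          unfolding integral_unique[OF I, symmetric]
        proof (rule integral_norm_bound_integral)
          show "velocity X1 X2 u \<gamma> integrable_on {a..b}" using I by blast
          show "(\<lambda>s. M * norm (u s)) integrable_on {a..b}"
            using int that by (intro integrable_on_mult_right) auto
          fix s assume s: "s \<in> {a..b}"
          have n: "\<bar>fst (u s)\<bar> \<le> norm (u s)" "\<bar>snd (u s)\<bar> \<le> norm (u s)"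
            by (metis norm_fst_le real_norm_def prod.collapse) (metis norm_snd_le real_norm_def prod.collapse)
          have "norm (velocity X1 X2 u \<gamma> s) \<le> \<bar>fst (u s)\<bar> * norm (X1 (\<gamma> s)) + \<bar>snd (u s)\<bar> * norm (X2 (\<gamma> s))"
            unfolding velocity_def by (rule order.trans[OF norm_triangle_ineq]) simp
          also have "\<dots> \<le> norm (u s) * norm (X1 (\<gamma> s)) + norm (u s) * norm (X2 (\<gamma> s))"
            by (intro add_mono mult_right_mono n) auto
          also have "\<dots> = norm (u s) * (norm (X1 (\<gamma> s)) + norm (X2 (\<gamma> s)))"
            by (simp add: algebra_simps)
          also have "\<dots> \<le> norm (u s) * M"
            using near[OF s] s that(1,3) d(3) by (intro mult_left_mono d3(2)) (linarith | simp)+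
          finally show "norm (velocity X1 X2 u \<gamma> s) \<le> M * norm (u s)" by (simp add: mult.commute)
        qed
        then show ?thesis by (simp add: len_def)
      qed
      have lin: "D (\<gamma> b - \<gamma> a) \<le> (1 + e / 2) * len a b"
        if "0 \<le> a" "a \<le> b" "b \<le> 1" and near: "\<And>s. s \<in> {a..b} \<Longrightarrow> \<bar>s - x\<bar> < d" for a b
      proof -
        have I: "((\<lambda>s. D (velocity X1 X2 u \<gamma> s)) has_integral D (\<gamma> b - \<gamma> a)) {a..b}"
          using has_integral_linear[OF horizontal_velocity_integral[OF h that(1-3)] bl] by (simp add: o_def)
        have J: "((\<lambda>s. (1 + e / 2) * norm (u s)) has_integral (1 + e / 2) * len a b) {a..b}"
          unfolding len_def using int that by (intro has_integral_mult_right integrable_integral) auto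
        show ?thesis
        proof (rule has_integral_le[OF I J])
          fix s assume s: "s \<in> {a..b}"
          have "D (velocity X1 X2 u \<gamma> s) = inner (u s) (D (X1 (\<gamma> s)), D (X2 (\<gamma> s)))"
            by (simp add: velocity_def linear_add linear_scale bounded_linear.linear[OF bl] inner_prod_def)
          also have "\<dots> \<le> norm (u s) * norm (D (X1 (\<gamma> s)), D (X2 (\<gamma> s)))"
            by (rule norm_cauchy_schwarz)
          also have "\<dots> \<le> norm (u s) * (1 + e / 2)"
            using near[OF s] s that(1,3) d(4) by (intro mult_left_mono d4(2)) (linarith | simp)+
          finally show "D (velocity X1 X2 u \<gamma> s) \<le> (1 + e / 2) * norm (u s)" by (simp add: mult.commute)
        qed
      qed
      show ?case
      proof (intro exI[of _ d] conjI d(1) allI impI)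
        fix a b assume ab: "a \<le> x \<and> x \<le> b \<and> b - a < d" "0 \<le> a" "b \<le> 1"
        have near: "\<bar>s - x\<bar> < d" if "s \<in> {a..b}" for s using ab that by auto
        have "\<bar>S (\<gamma> b) - S (\<gamma> x) - D (\<gamma> b - \<gamma> x)\<bar> \<le> e / (2 * M) * norm (\<gamma> b - \<gamma> x)"
          by (intro d1(2) d2(2)) (use near[of b] ab d in auto)
        also have "\<dots> \<le> e / (2 * M) * (M * len x b)"
          using e1 ab by (intro mult_left_mono incr near) auto
        finally have 1: "\<bar>S (\<gamma> b) - S (\<gamma> x) - D (\<gamma> b - \<gamma> x)\<bar> \<le> e / 2 * len x b"
          using M by simp
        have "\<bar>S (\<gamma> a) - S (\<gamma> x) - D (\<gamma> a - \<gamma> x)\<bar> \<le> e / (2 * M) * norm (\<gamma> a - \<gamma> x)"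
          by (intro d1(2) d2(2)) (use near[of a] ab d in auto)
        also have "\<dots> = e / (2 * M) * norm (\<gamma> x - \<gamma> a)" by (simp add: norm_minus_commute)
        also have "\<dots> \<le> e / (2 * M) * (M * len a x)"
          using e1 ab by (intro mult_left_mono incr near) auto
        finally have 2: "\<bar>S (\<gamma> a) - S (\<gamma> x) - D (\<gamma> a - \<gamma> x)\<bar> \<le> e / 2 * len a x"
          using M by simp
        have 3: "D (\<gamma> b - \<gamma> a) = D (\<gamma> b - \<gamma> x) - D (\<gamma> a - \<gamma> x)"
          by (simp add: linear_diff bounded_linear.linear[OF bl])
        have "S (\<gamma> b) - S (\<gamma> a) \<le> D (\<gamma> b - \<gamma> a) + e / 2 * (len a x + len x b)"
          using abs_le_D1[OF 1] abs_le_D2[OF 2] 3 unfolding distrib_left by linarith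
        also have "\<dots> \<le> (1 + e / 2) * len a b + e / 2 * len a b"
          using lin[of a b] near ab len_add[of a x b] by auto
        finally show "S (\<gamma> b) - S (\<gamma> a) \<le> (1 + e) * len a b"
          by (simp add: algebra_simps)
      qed
    qed
    then show ?thesis by simp
  qed
  have "((\<lambda>e. (1 + e) * len 0 1) \<longlongrightarrow> (1 + 0) * len 0 1) (at_right 0)"
    by (intro tendsto_intros)
  then have "S (\<gamma> 1) - S (\<gamma> 0) \<le> (1 + 0) * len 0 1"
    by (rule tendsto_lowerbound)
       (use key in \<open>auto intro: eventually_mono[OF eventually_at_right_less]\<close>)
  then show ?thesis by (simp add: len_def)
qed


section \<open>The topology of the Martinet distance\<close>

lemma mar_dist_le_length: "l \<in> sr_lengths mar_X1 mar_X2 p q \<Longrightarrow> mar_dist p q \<le> l"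
  unfolding mar_dist_def sr_dist_def by (rule cInf_lower[OF _ sr_lengths_bdd])

lemma mar_dist_nearly_attained:
  assumes "mar_dist p q < r"
  obtains l where "l \<in> sr_lengths mar_X1 mar_X2 p q" "l < r"
  using cInf_lessD[OF mar_connected[of p q], of r] assms by (auto simp: mar_dist_def sr_dist_def)

lemma mar_dist_commute: "mar_dist p q = mar_dist q p"
  using mdist_commute[of Mar p q] by simp

lemma mar_dist_triangle: "mar_dist p r \<le> mar_dist p q + mar_dist q r"
  using mdist_triangle[of p Mar q r] by simp

lemma mar_dist_move_X1: "mar_dist (x, y, z) (x + a, y, z) \<le> \<bar>a\<bar>"
proof (rule mar_dist_le_length, rule sr_lengthsI)
  have "((\<lambda>s::real. (a, 0::real, 0::real)) has_integral (t *\<^sub>R (a, 0, 0))) {0..t}" if "0 \<le> t" for t :: real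
    using has_integral_const_real[of "(a, 0::real, 0::real)" 0 t] that by simp
  then show "horizontal mar_X1 mar_X2 (\<lambda>_. (a, 0)) (\<lambda>t. (x + t * a, y, z))"
    by (simp add: horizontal_def velocity_def[abs_def] mar_X1_def mar_X2_def zero_prod_def)
  show "((\<lambda>s::real. norm (a, 0::real)) has_integral \<bar>a\<bar>) {0..1}"
    using has_integral_const_real[of "\<bar>a\<bar>" 0 1] by simp
qed auto

lemma mar_dist_move_X2: "mar_dist (x, y, z) (x, y + b, z + b * (x\<^sup>2 / 2)) \<le> \<bar>b\<bar>"
proof (rule mar_dist_le_length, rule sr_lengthsI)
  have "((\<lambda>s::real. (0::real, b, b * x\<^sup>2 / 2)) has_integral (t *\<^sub>R (0, b, b * x\<^sup>2 / 2))) {0..t}"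
    if "0 \<le> t" for t :: real
    using has_integral_const_real[of "(0::real, b, b * x\<^sup>2 / 2)" 0 t] that by simp
  then show "horizontal mar_X1 mar_X2 (\<lambda>_. (0, b)) (\<lambda>t. (x, y + t * b, z + t * b * (x\<^sup>2 / 2)))"
    by (simp add: horizontal_def velocity_def[abs_def] mar_X1_def mar_X2_def mult.assoc)
  show "((\<lambda>s::real. norm (0::real, b)) has_integral \<bar>b\<bar>) {0..1}"
    using has_integral_const_real[of "\<bar>b\<bar>" 0 1] by simp
qed auto

text \<open>Going around a rectangle with sides \<open>\<sigma> h\<close> and \<open>b\<close> in the \<open>(x, y)\<close>-plane changes \<open>z\<close> by
  \<open>b ((x + \<sigma> h)\<^sup>2 - x\<^sup>2) / 2\<close>. The sign \<open>\<sigma>\<close> is chosen such that the loop moves away from the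
  Martinet surface \<open>x = 0\<close>; then the change is at least \<open>\<bar>b\<bar> h\<^sup>2 / 2\<close> in size, and \<open>h\<^sup>3 = \<bar>c\<bar>\<close> makes all sides
  of order \<open>h\<close>.\<close>

lemma mar_dist_vertical: "mar_dist (x, y, z) (x, y, z + c) \<le> 6 * root 3 \<bar>c\<bar>"
proof (cases "c = 0")
  case True
  then show ?thesis
    using Metric_space.mdist_zero[OF Metric_space_mar_dist, of "(x, y, z)"] by simp
next
  case False
  define h where "h = root 3 \<bar>c\<bar>"
  have h0: "0 < h" and h3: "h ^ 3 = \<bar>c\<bar>"
    using False by (simp_all add: h_def real_root_pow_pos2)
  obtain \<sigma> :: real where \<sigma>: "\<bar>\<sigma>\<bar> = 1" "\<sigma> * x = \<bar>x\<bar>" "\<sigma> * \<sigma> = 1"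
    by (cases "0 \<le> x") (auto intro: that[of 1] that[of "-1"])
  define b where "b = c / (h * (\<bar>x\<bar> + h / 2))"
  have "h * (h / 2) \<le> h * (\<bar>x\<bar> + h / 2)"
    using h0 by (intro mult_left_mono) auto
  then have "\<bar>b\<bar> \<le> \<bar>c\<bar> / (h * (h / 2))"
    unfolding b_def abs_divide using h0 by (intro divide_left_mono) (auto simp: abs_mult intro!: mult_pos_pos add_nonneg_pos)
  also have "\<dots> = 2 * h"
    using h0 unfolding h3[symmetric] by (simp add: field_simps power3_eq_cube)
  finally have b: "\<bar>b\<bar> \<le> 2 * h" .
  have "h * (\<bar>x\<bar> + h / 2) \<noteq> 0" using h0 by (smt (verit) mult_pos_pos divide_pos_pos)
  then have c: "c = b * (h * (\<bar>x\<bar> + h / 2))" by (simp add: b_def)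
  define p1 where "p1 = (x + \<sigma> * h, y, z)"
  define p2 where "p2 = (x + \<sigma> * h, y + b, z + b * ((x + \<sigma> * h)\<^sup>2 / 2))"
  define p3 where "p3 = (x, y + b, z + b * ((x + \<sigma> * h)\<^sup>2 / 2))"
  have "z + b * ((x + \<sigma> * h)\<^sup>2 / 2) + - b * (x\<^sup>2 / 2) = z + b * (h * (\<sigma> * x) + \<sigma> * \<sigma> * h * h / 2)"
    by (simp add: power2_eq_square field_simps)
  also have "\<dots> = z + c"
    unfolding \<sigma> c by (simp add: algebra_simps)
  finally have z: "z + b * ((x + \<sigma> * h)\<^sup>2 / 2) + - b * (x\<^sup>2 / 2) = z + c" .
  have "mar_dist (x, y, z) p1 \<le> h"
    using mar_dist_move_X1[of x y z "\<sigma> * h"] h0 \<sigma> by (simp add: p1_def abs_mult)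
  moreover have "mar_dist p1 p2 \<le> 2 * h"
    using mar_dist_move_X2[of "x + \<sigma> * h" y z b] b by (simp add: p1_def p2_def)
  moreover have "mar_dist p2 p3 \<le> h"
    using mar_dist_move_X1[of "x + \<sigma> * h" "y + b" "z + b * ((x + \<sigma> * h)\<^sup>2 / 2)" "- (\<sigma> * h)"] h0 \<sigma>
    by (simp add: p2_def p3_def abs_mult)
  moreover have "mar_dist p3 (x, y, z + c) \<le> 2 * h"
    using mar_dist_move_X2[of x "y + b" "z + b * ((x + \<sigma> * h)\<^sup>2 / 2)" "- b"] b
    unfolding z p3_def by simp
  ultimately have "mar_dist (x, y, z) (x, y, z + c) \<le> 6 * h"
    using mar_dist_triangle[of "(x, y, z)" "(x, y, z + c)" p1]
      mar_dist_triangle[of p1 "(x, y, z + c)" p2] mar_dist_triangle[of p2 "(x, y, z + c)" p3]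
    by linarith
  then show ?thesis by (simp add: h_def)
qed

lemma mar_dist_upper_bound:
  "mar_dist (x, y, z) (x', y', z')
     \<le> \<bar>x' - x\<bar> + \<bar>y' - y\<bar> + 6 * root 3 \<bar>z' - z - (y' - y) * (x'\<^sup>2 / 2)\<bar>"
proof -
  define p1 where "p1 = (x', y, z)"
  define p2 where "p2 = (x', y', z + (y' - y) * (x'\<^sup>2 / 2))"
  have "mar_dist (x, y, z) p1 \<le> \<bar>x' - x\<bar>"
    using mar_dist_move_X1[of x y z "x' - x"] by (simp add: p1_def)
  moreover have "mar_dist p1 p2 \<le> \<bar>y' - y\<bar>"
    using mar_dist_move_X2[of x' y z "y' - y"] by (simp add: p1_def p2_def)
  moreover have "mar_dist p2 (x', y', z') \<le> 6 * root 3 \<bar>z' - z - (y' - y) * (x'\<^sup>2 / 2)\<bar>"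
    using mar_dist_vertical[of x' y' "z + (y' - y) * (x'\<^sup>2 / 2)" "z' - z - (y' - y) * (x'\<^sup>2 / 2)"]
    by (simp add: p2_def)
  ultimately show ?thesis
    using mar_dist_triangle[of "(x, y, z)" "(x', y', z')" p1]
      mar_dist_triangle[of p1 "(x', y', z')" p2] by linarith
qed

text \<open>Coordinates are controlled by lengths through \<open>mar_length_bounds\<close>, and conversely the bound of
  \<open>mar_dist_upper_bound\<close> is continuous and vanishes at the centre.\<close>

lemma openin_Mar_iff_open: "openin (mtopology_of Mar) U \<longleftrightarrow> open U"
proof -
  have mop: "openin (mtopology_of Mar) U \<longleftrightarrow> (\<forall>p\<in>U. \<exists>r>0. \<forall>q. mar_dist p q < r \<longrightarrow> q \<in> U)"
    unfolding mtopology_of_def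
    by (subst Metric_space.openin_mtopology)
       (auto simp: Metric_space.in_mball Metric_space_mar_dist subset_iff)
  show ?thesis
  proof
    assume "open U"
    show "openin (mtopology_of Mar) U"
      unfolding mop
    proof
      fix p assume "p \<in> U"
      then obtain e where e: "0 < e" "\<And>q. dist q p < e \<Longrightarrow> q \<in> U"
        using \<open>open U\<close> unfolding open_dist by blast
      obtain x y z where p: "p = (x, y, z)" by (cases p)
      define C where "C = 2 + (\<bar>x\<bar> + 1)\<^sup>2 / 2"
      have C: "0 < C" by (simp add: C_def add_pos_nonneg)
      define r where "r = min 1 (e / C)"
      have r: "0 < r" "r \<le> 1" "C * r \<le> e" using e C by (auto simp: r_def min_def field_simps)
      have "q \<in> U" if pq: "mar_dist p q < r" for q
      proof -
        obtain l where l: "l \<in> sr_lengths mar_X1 mar_X2 p q" "l < r"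
          using mar_dist_nearly_attained[OF pq] by blast
        obtain x' y' z' where q: "q = (x', y', z')" by (cases q)
        note b = mar_length_bounds[OF l(1)[unfolded p q]]
        have l0: "0 \<le> l" using l sr_lengths_nonneg by blast
        have "(\<bar>x\<bar> + l)\<^sup>2 / 2 * l \<le> (\<bar>x\<bar> + 1)\<^sup>2 / 2 * l"
          using l0 l(2) r by (intro mult_right_mono divide_right_mono power_mono) auto
        then have "\<bar>x' - x\<bar> + (\<bar>y' - y\<bar> + \<bar>z' - z\<bar>) \<le> C * l"
          using b by (simp add: C_def algebra_simps)
        also have "\<dots> < C * r" using l C by simp
        also have "\<dots> \<le> e" by (rule r)
        finally have "\<bar>x' - x\<bar> + (\<bar>y' - y\<bar> + \<bar>z' - z\<bar>) < e" .
        moreover have "dist q p \<le> \<bar>x' - x\<bar> + (\<bar>y' - y\<bar> + \<bar>z' - z\<bar>)"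
          unfolding p q dist_Pair_Pair dist_real_def
          by (rule order.trans[OF sqrt_sum_squares_le_sum_abs])
             (auto intro: order.trans[OF sqrt_sum_squares_le_sum_abs])
        ultimately show ?thesis by (intro e(2)) linarith
      qed
      then show "\<exists>r>0. \<forall>q. mar_dist p q < r \<longrightarrow> q \<in> U" using r by blast
    qed
  next
    assume "openin (mtopology_of Mar) U"
    have "eventually (\<lambda>q. q \<in> U) (nhds p)" if pU: "p \<in> U" for p
    proof -
      obtain r where r: "0 < r" "\<And>q. mar_dist p q < r \<Longrightarrow> q \<in> U"
        using \<open>openin (mtopology_of Mar) U\<close> pU unfolding mop by blast
      obtain x y z where p: "p = (x, y, z)" by (cases p)
      define f where "f = (\<lambda>q. \<bar>fst q - x\<bar> + \<bar>fst (snd q) - y\<bar>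
        + 6 * root 3 \<bar>snd (snd q) - z - (fst (snd q) - y) * ((fst q)\<^sup>2 / 2)\<bar>)"
      have "isCont f p"
        unfolding f_def by (intro continuous_intros) auto
      then have "(f \<longlongrightarrow> f p) (nhds p)"
        by (simp add: continuous_at tendsto_nhds_iff)
      moreover have "f p < r" using r by (simp add: f_def p)
      ultimately have "eventually (\<lambda>q. f q < r) (nhds p)"
        by (rule order_tendstoD)
      then show ?thesis
      proof (rule eventually_mono)
        fix q assume "f q < r"
        moreover have "mar_dist p q \<le> f q"
          using mar_dist_upper_bound[of x y z "fst q" "fst (snd q)" "snd (snd q)"]
          by (simp add: f_def p)
        ultimately show "q \<in> U" using r by auto
      qed
    qed
    then show "open U"
      by (subst open_subopen) (simp only: eventually_nhds subset_iff Ball_def, blast)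
  qed
qed

lemma mtopology_of_Mar: "mtopology_of Mar = euclidean"
  by (simp add: topology_eq openin_Mar_iff_open)

lemma sets_mborel_Mar: "sets (mborel Mar) = sets borel"
  unfolding mborel_def borel_def by (simp add: mtopology_of_Mar)


section \<open>An upper bound for the distance from the origin\<close>

text \<open>The competitor is the graph \<open>x = a s ^ (n + 1)\<close> over the interval \<open>{y0..y0 + r}\<close>. With
  \<open>\<kappa> = (n + 1) / r\<close> it imitates the optimal profile \<open>exp (\<kappa> y)\<close>; unlike the exponential it starts
  exactly on the line \<open>x = 0\<close>, and \<open>r\<close> is a free parameter with which every value of
  the last coordinate can be matched.\<close>

lemma mar_ramp_length:
  fixes a y0 w r :: real and n :: nat
  assumes r: "0 < r"
  shows "mar_dist (0, y0, w) (a, y0 + r, w + a\<^sup>2 * r / (2 * (2 * real n + 3)))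
    \<le> r + a\<^sup>2 * (real n + 1)\<^sup>2 / (2 * r * (2 * real n + 1))"
proof -
  define u where "u = (\<lambda>s :: real. (a * (real n + 1) * s ^ n, r))"
  define \<gamma> where "\<gamma> = (\<lambda>s :: real. (a * s ^ (n + 1), y0 + r * s,
    w + a\<^sup>2 * r / (2 * (2 * real n + 3)) * s ^ (2 * n + 3)))"
  have cont: "continuous_on {0..1} u" unfolding u_def by (intro continuous_intros)
  have "(\<gamma> has_vector_derivative velocity mar_X1 mar_X2 u \<gamma> s) (at s within A)" for s A
  proof -
    have s2: "s ^ (2 * n + 2) = s ^ (n + 1) * s ^ (n + 1)"
      by (subst power_add[symmetric]) (simp add: mult_2)
    have cancel: "a\<^sup>2 * r / (2 * m) * (m * (t * t)) = r * ((a * t)\<^sup>2 / 2)" if "0 < m" for m t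
      using that by (simp add: field_simps power2_eq_square)
    have z: "a\<^sup>2 * r / (2 * (2 * real n + 3)) * ((2 * real n + 3) * s ^ (2 * n + 2))
        = r * ((a * s ^ (n + 1))\<^sup>2 / 2)"
      unfolding s2 by (rule cancel) linarith
    have "velocity mar_X1 mar_X2 u \<gamma> s = (a * ((real n + 1) * s ^ n), r,
        a\<^sup>2 * r / (2 * (2 * real n + 3)) * ((2 * real n + 3) * s ^ (2 * n + 2)))"
      unfolding z by (simp add: velocity_def u_def \<gamma>_def mar_X1_def mar_X2_def)
    moreover have "((\<lambda>s. a * s ^ (n + 1)) has_vector_derivative a * ((real n + 1) * s ^ n)) (at s within A)"
      unfolding has_real_derivative_iff_has_vector_derivative[symmetric]
      using DERIV_cmult[OF DERIV_pow[of "n + 1" s A], of a] by (simp add: add.commute)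
    moreover have "((\<lambda>s. y0 + r * s) has_vector_derivative r) (at s within A)"
      unfolding has_real_derivative_iff_has_vector_derivative[symmetric]
      by (auto intro!: derivative_eq_intros)
    moreover have "((\<lambda>s. w + a\<^sup>2 * r / (2 * (2 * real n + 3)) * s ^ (2 * n + 3)) has_vector_derivative
        a\<^sup>2 * r / (2 * (2 * real n + 3)) * ((2 * real n + 3) * s ^ (2 * n + 2))) (at s within A)"
      unfolding has_real_derivative_iff_has_vector_derivative[symmetric]
      by (auto intro!: derivative_eq_intros)
    ultimately show ?thesis
      unfolding \<gamma>_def by (simp only:) (intro has_vector_derivative_Pair)
  qed
  then have "(velocity mar_X1 mar_X2 u \<gamma> has_integral \<gamma> t - \<gamma> 0) {0..t}" if "t \<in> {0..1}" for t
    using that by (intro fundamental_theorem_of_calculus) auto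
  then have h: "horizontal mar_X1 mar_X2 u \<gamma>"
    unfolding horizontal_def using absolutely_integrable_continuous_real[OF cont] by blast
  have nI: "((\<lambda>s. norm (u s)) has_integral integral {0..1} (\<lambda>s. norm (u s))) {0..1}"
    by (intro integrable_integral integrable_continuous_real continuous_intros cont)
  have "mar_dist (0, y0, w) (a, y0 + r, w + a\<^sup>2 * r / (2 * (2 * real n + 3))) \<le> integral {0..1} (\<lambda>s. norm (u s))"
    by (rule mar_dist_le_length, rule sr_lengthsI[OF h _ _ nI]) (simp_all add: \<gamma>_def)
  also have "\<dots> \<le> r + a\<^sup>2 * (real n + 1)\<^sup>2 / (2 * r * (2 * real n + 1))"
  proof (rule has_integral_le[OF nI])
    define c where "c = a\<^sup>2 * (real n + 1)\<^sup>2 / (2 * r)"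
    have "((\<lambda>s. r + c * s ^ (2 * n)) has_integral
        (r * 1 + c * (1 ^ (2 * n + 1) / (2 * real n + 1))) - (r * 0 + c * (0 ^ (2 * n + 1) / (2 * real n + 1)))) {0..1}"
    proof (rule fundamental_theorem_of_calculus)
      fix s :: real
      have "2 * real n + 1 \<noteq> 0" by linarith
      then show "((\<lambda>s. r * s + c * (s ^ (2 * n + 1) / (2 * real n + 1))) has_vector_derivative
          r + c * s ^ (2 * n)) (at s within {0..1})"
        unfolding has_real_derivative_iff_has_vector_derivative[symmetric]
        using DERIV_add[OF DERIV_cmult[OF DERIV_ident, of r s "{0..1}"]
            DERIV_cmult[OF DERIV_cdivide[OF DERIV_pow[of "2 * n + 1" s "{0..1}"], of "2 * real n + 1"], of c]]
        by (simp add: add.commute)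
    qed simp
    then show "((\<lambda>s. r + c * s ^ (2 * n)) has_integral
        r + a\<^sup>2 * (real n + 1)\<^sup>2 / (2 * r * (2 * real n + 1))) {0..1}"
      by (simp add: c_def)
    fix s :: real assume "s \<in> {0..1}"
    define v where "v = a * (real n + 1) * s ^ n"
    have v: "v\<^sup>2 = a\<^sup>2 * (real n + 1)\<^sup>2 * s ^ (2 * n)"
      by (simp add: v_def power_mult_distrib power_mult[symmetric] mult.commute)
    have "v\<^sup>2 + r\<^sup>2 \<le> (r + v\<^sup>2 / (2 * r))\<^sup>2"
      using r by (simp add: power2_sum field_simps) (simp add: power2_eq_square)
    then have "sqrt (v\<^sup>2 + r\<^sup>2) \<le> r + v\<^sup>2 / (2 * r)"
      using r by (intro real_le_lsqrt) auto
    then show "norm (u s) \<le> r + c * s ^ (2 * n)"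
      by (simp add: u_def norm_Pair v_def[symmetric] v c_def)
  qed
  finally show ?thesis .
qed

lemma mar_dist_origin_le:
  fixes a y r :: real and n :: nat
  assumes "0 < r" "r \<le> y"
  shows "mar_dist (0, 0, 0) (a, y, a\<^sup>2 * r / (2 * (2 * real n + 3)))
    \<le> y + a\<^sup>2 * (real n + 1)\<^sup>2 / (2 * r * (2 * real n + 1))"
proof -
  have "mar_dist (0, 0, 0) (0, y - r, 0) \<le> y - r"
    using mar_dist_move_X2[of 0 0 0 "y - r"] assms by simp
  moreover have "mar_dist (0, y - r, 0) (a, y, a\<^sup>2 * r / (2 * (2 * real n + 3)))
      \<le> r + a\<^sup>2 * (real n + 1)\<^sup>2 / (2 * r * (2 * real n + 1))"
    using mar_ramp_length[OF assms(1), of "y - r" 0 a n] by simp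
  ultimately show ?thesis
    using mar_dist_triangle[of "(0, 0, 0)" "(a, y, a\<^sup>2 * r / (2 * (2 * real n + 3)))" "(0, y - r, 0)"]
    by linarith
qed


section \<open>Planar confinement and calibrations in the Martinet structure\<close>

definition planar :: "real \<times> real \<times> real \<Rightarrow> real \<times> real" where
  "planar p = (fst p, fst (snd p))"

text \<open>The control of a horizontal curve is the velocity of its projection to the \<open>(x, y)\<close>-plane, so
  horizontal length is the Euclidean length of the projection.\<close>

lemma planar_length:
  assumes h: "horizontal mar_X1 mar_X2 u \<gamma>" and ab: "0 \<le> a" "a \<le> b" "b \<le> 1"
  shows "norm (planar (\<gamma> b) - planar (\<gamma> a)) \<le> integral {a..b} (\<lambda>s. norm (u s))"
proof -
  have bl: "bounded_linear planar"
    unfolding planar_def[abs_def]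
    by (intro bounded_linear_Pair bounded_linear_fst bounded_linear_compose[OF bounded_linear_fst bounded_linear_snd])
  have "planar \<circ> velocity mar_X1 mar_X2 u \<gamma> = u"
    by (auto simp: fun_eq_iff planar_def velocity_def mar_X1_def mar_X2_def split: prod.split)
  with has_integral_linear[OF horizontal_velocity_integral[OF h ab] bl]
  have I: "(u has_integral planar (\<gamma> b) - planar (\<gamma> a)) {a..b}"
    by (simp add: linear_diff bounded_linear.linear[OF bl])
  have "(\<lambda>s. norm (u s)) integrable_on {a..b}"
    by (rule integrable_subinterval_real[of _ 0 1])
       (use h ab in \<open>auto simp: horizontal_def absolutely_integrable_on_def\<close>)
  then show ?thesis
    unfolding integral_unique[OF I, symmetric]
    by (intro integral_norm_bound_integral) (use I in auto)
qed

lemma planar_detour: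
  assumes h: "horizontal mar_X1 mar_X2 u \<gamma>" and s: "s \<in> {0..1}"
  shows "norm (planar (\<gamma> s) - planar (\<gamma> 0)) + norm (planar (\<gamma> 1) - planar (\<gamma> s))
    \<le> integral {0..1} (\<lambda>s. norm (u s))"
proof -
  have "(\<lambda>s. norm (u s)) integrable_on {0..1}"
    using h by (auto simp: horizontal_def absolutely_integrable_on_def)
  then have "integral {0..1} (\<lambda>s. norm (u s)) = integral {0..s} (\<lambda>s. norm (u s)) + integral {s..1} (\<lambda>s. norm (u s))"
    using s by (intro Henstock_Kurzweil_Integration.integral_combine[symmetric]) auto
  then show ?thesis
    using planar_length[OF h, of 0 s] planar_length[OF h, of s 1] s by auto
qed

text \<open>The hypothesis puts \<open>(x, y')\<close> in the Euclidean ellipse with foci at the origin and at \<open>(a, y)\<close>.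
  Reflecting the second leg in the line through \<open>(x, y')\<close> parallel to the \<open>y\<close>-axis turns the
  detour into a path from the origin to \<open>(2 x - a, y)\<close>, which bounds \<open>x\<close> in terms of the excess \<open>L - y\<close>.\<close>

lemma planar_ellipse:
  fixes a y L x y' :: real
  assumes "norm (x, y') + norm (a - x, y - y') \<le> L"
  shows "(2 * x - a)\<^sup>2 + y\<^sup>2 \<le> L\<^sup>2" and "\<bar>y'\<bar> + \<bar>y - y'\<bar> \<le> L"
proof -
  have "norm (2 * x - a, y) \<le> norm (x, y') + norm (x - a, y - y')"
    using norm_triangle_ineq[of "(x, y')" "(x - a, y - y')"] by simp
  also have "norm (x - a, y - y') = norm (a - x, y - y')"
    by (simp add: norm_Pair power2_commute)
  finally have "norm (2 * x - a, y) \<le> L" using assms by linarith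
  then have "(norm (2 * x - a, y))\<^sup>2 \<le> L\<^sup>2"
    by (intro power_mono) auto
  then show "(2 * x - a)\<^sup>2 + y\<^sup>2 \<le> L\<^sup>2"
    by (simp add: norm_Pair)
  show "\<bar>y'\<bar> + \<bar>y - y'\<bar> \<le> L"
    using assms norm_snd_le[of y' x] norm_snd_le[of "y - y'" "a - x"] by simp
qed

text \<open>The horizontal gradient of \<open>y - c z + (\<alpha> y + \<beta>) x\<^sup>2 / 2\<close> is
  \<open>((\<alpha> y + \<beta>) x, 1 - (c - \<alpha>) x\<^sup>2 / 2)\<close>. The hypothesis is what remains of the condition that its
  norm is at most 1 after division by \<open>x\<^sup>2\<close>. Up to a term of order \<open>x\<^sup>2\<close> it is the Riccati
  inequality \<open>\<phi>' + \<phi>\<^sup>2 \<le> c\<close> for \<open>\<phi> = \<alpha> y + \<beta>\<close>.\<close>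

lemma mar_calibration:
  fixes \<alpha> \<beta> c :: real
  assumes h: "horizontal mar_X1 mar_X2 u \<gamma>"
    and ric: "\<And>s x y z. \<lbrakk>s \<in> {0..1}; \<gamma> s = (x, y, z)\<rbrakk>
      \<Longrightarrow> (\<alpha> * y + \<beta>)\<^sup>2 + (c - \<alpha>)\<^sup>2 * x\<^sup>2 / 4 \<le> c - \<alpha>"
    and ends: "\<gamma> 0 = (x0, y0, z0)" "\<gamma> 1 = (x1, y1, z1)"
  shows "(y1 - c * z1 + (\<alpha> * y1 + \<beta>) * x1\<^sup>2 / 2) - (y0 - c * z0 + (\<alpha> * y0 + \<beta>) * x0\<^sup>2 / 2)
    \<le> integral {0..1} (\<lambda>s. norm (u s))"
proof -
  define S :: "real \<times> real \<times> real \<Rightarrow> real"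
    where "S = (\<lambda>p. fst (snd p) - c * snd (snd p) + (\<alpha> * fst (snd p) + \<beta>) * (fst p)\<^sup>2 / 2)"
  define S' :: "real \<times> real \<times> real \<Rightarrow> real \<times> real \<times> real \<Rightarrow> real"
    where "S' = (\<lambda>p v. fst (snd v) - c * snd (snd v) + \<alpha> * fst (snd v) * (fst p)\<^sup>2 / 2
      + (\<alpha> * fst (snd p) + \<beta>) * fst p * fst v)"
  have der: "(S has_derivative S' p) (at p)" for p
    unfolding S_def S'_def by (auto intro!: derivative_eq_intros simp: field_simps power2_eq_square)
  have "S (\<gamma> 1) - S (\<gamma> 0) \<le> integral {0..1} (\<lambda>s. norm (u s))"
  proof (rule calibration_le_length[OF h, where S' = "\<lambda>s. S' (\<gamma> s)"])
    show "continuous_on UNIV mar_X1" "continuous_on UNIV mar_X2"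
      unfolding mar_X1_def mar_X2_def case_prod_unfold by (intro continuous_intros; simp)+
    show "(S has_derivative S' (\<gamma> s)) (at (\<gamma> s))" for s by (rule der)
    fix s :: real assume s: "s \<in> {0..1}"
    obtain x y z where g: "\<gamma> s = (x, y, z)" by (cases "\<gamma> s")
    have "x\<^sup>2 * ((\<alpha> * y + \<beta>)\<^sup>2 + (c - \<alpha>)\<^sup>2 * x\<^sup>2 / 4) \<le> x\<^sup>2 * (c - \<alpha>)"
      by (intro mult_left_mono ric[OF s g]) auto
    moreover have "S' (\<gamma> s) (mar_X1 (\<gamma> s)) = (\<alpha> * y + \<beta>) * x"
      "S' (\<gamma> s) (mar_X2 (\<gamma> s)) = 1 - (c - \<alpha>) * x\<^sup>2 / 2"
      by (simp_all add: S'_def g mar_X1_def mar_X2_def field_simps)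
    moreover have "(A * x)\<^sup>2 + (1 - D * x\<^sup>2 / 2)\<^sup>2 = 1 + x\<^sup>2 * (A\<^sup>2 + D\<^sup>2 * x\<^sup>2 / 4) - x\<^sup>2 * D" for A D
      by (simp add: power2_eq_square field_simps)
    ultimately show "(S' (\<gamma> s) (mar_X1 (\<gamma> s)))\<^sup>2 + (S' (\<gamma> s) (mar_X2 (\<gamma> s)))\<^sup>2 \<le> 1"
      by simp
  qed
  then show ?thesis by (simp add: S_def ends)
qed


section \<open>Location of midpoints\<close>

text \<open>Two calibrations meet at \<open>q = (xq, yq, zq)\<close>. After \<open>q\<close>, with coefficient \<open>c = \<kappa>\<^sup>2\<close>, the slope
  \<open>\<phi>\<close> rises linearly from below \<open>\<kappa> / 2\<close> at \<open>yq\<close> to \<open>\<kappa> - 1\<close> at the endpoint; as \<open>y - yq\<close> is about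
  \<open>y / 2\<close>, the rate \<open>\<kappa>\<close> suffices for this, and by the Riccati inequality it lowers the final value, which
  could be \<open>\<kappa>\<close> for constant slope, by a bounded amount only. Before \<open>q\<close> the slope is constantly \<open>\<kappa> / 2\<close>, far enough below \<open>\<kappa>\<close> to leave \<open>c\<close>
  free between \<open>\<kappa>\<^sup>2 / 2\<close> and \<open>3 \<kappa>\<^sup>2 / 2\<close>. Adding the two inequalities and comparing with the
  upper bound \<open>action\<close> for the total length leaves \<open>(\<kappa>\<^sup>2 - c) zq + xq\<^sup>2 / 4 \<le> 3 a\<^sup>2 / 2\<close>, and the two
  extreme values of \<open>c\<close> bound \<open>zq\<close> from both sides. The smallness of \<open>\<kappa>\<^sup>3 a\<close> keeps the curves so
  close to the line \<open>x = 0\<close> that the terms of order \<open>x\<^sup>2\<close> in the calibration conditions are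
  absorbed.\<close>

lemma midpoint_estimate:
  fixes a y z xq yq zq \<kappa> l1 l2 :: real
  assumes \<kappa>: "8 \<le> \<kappa>" and a: "0 < a" "\<kappa> ^ 3 * a \<le> 1" and y: "1 \<le> y" "y \<le> 3/2"
    and l1: "l1 \<in> sr_lengths mar_X1 mar_X2 (0, 0, 0) (xq, yq, zq)"
    and l2: "l2 \<in> sr_lengths mar_X1 mar_X2 (xq, yq, zq) (a, y, z)"
    and excess: "l1 + l2 \<le> y + a\<^sup>2 * (\<kappa> + 1) / 2"
    and action: "l1 + l2 + \<kappa>\<^sup>2 * z \<le> y + a\<^sup>2 * (\<kappa> + 2) / 2"
    and half: "l1 \<le> y / 2 + a\<^sup>2 * (\<kappa> + 1) / 2"
  shows "xq\<^sup>2 \<le> 6 * a\<^sup>2" and "\<bar>zq\<bar> \<le> 3 * a\<^sup>2 / \<kappa>\<^sup>2"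
proof -
  define L where "L = l1 + l2"
  define \<delta> where "\<delta> = a\<^sup>2 * (\<kappa> + 1) / 2"
  have \<kappa>6: "\<kappa> ^ 6 * a\<^sup>2 \<le> 1"
  proof -
    have "(\<kappa> ^ 3 * a)\<^sup>2 \<le> 1\<^sup>2" using \<kappa> a by (intro power_mono) auto
    then show ?thesis by (simp add: power_mult_distrib flip: power_mult)
  qed
  have \<delta>: "0 < \<delta>" "\<kappa> * \<delta> \<le> 1/4"
  proof -
    show "0 < \<delta>" using a \<kappa> by (simp add: \<delta>_def)
    have "\<kappa> * (\<kappa> + 1) / 2 \<le> \<kappa> ^ 6 / 4"
    proof -
      have "8 * \<kappa> \<le> \<kappa> * \<kappa>" using \<kappa> by (intro mult_right_mono) auto
      then have "\<kappa> * (\<kappa> + 1) \<le> 2 * \<kappa> ^ 2" using \<kappa> by (simp add: power2_eq_square algebra_simps)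
      also have "\<dots> \<le> \<kappa> ^ 2 * \<kappa> ^ 4 / 2"
      proof -
        have "8 ^ 4 \<le> \<kappa> ^ 4" using \<kappa> by (intro power_mono) auto
        then have "\<kappa> ^ 2 * 4 \<le> \<kappa> ^ 2 * \<kappa> ^ 4" by (intro mult_left_mono) auto
        then show ?thesis by linarith
      qed
      finally show ?thesis by (simp flip: power_add)
    qed
    then have "a\<^sup>2 * (\<kappa> * (\<kappa> + 1) / 2) \<le> a\<^sup>2 * (\<kappa> ^ 6 / 4)"
      by (rule mult_left_mono) simp
    moreover have "\<kappa> * \<delta> = a\<^sup>2 * (\<kappa> * (\<kappa> + 1) / 2)" by (simp add: \<delta>_def)
    moreover have "a\<^sup>2 * (\<kappa> ^ 6 / 4) \<le> 1/4" using \<kappa>6 by (simp add: mult.commute)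
    ultimately show "\<kappa> * \<delta> \<le> 1/4" by linarith
  qed
  have \<delta>8: "\<delta> \<le> 1/32"
  proof -
    have "8 * \<delta> \<le> \<kappa> * \<delta>" using \<kappa> \<delta> by (intro mult_right_mono) auto
    then show ?thesis using \<delta> by linarith
  qed
  have L: "L \<le> y + \<delta>" using excess by (simp add: L_def \<delta>_def)
  obtain u1 \<gamma>1 where h1: "horizontal mar_X1 mar_X2 u1 \<gamma>1" "\<gamma>1 0 = (0, 0, 0)" "\<gamma>1 1 = (xq, yq, zq)"
    and l1_eq: "l1 = integral {0..1} (\<lambda>s. norm (u1 s))"
    using l1 unfolding sr_lengths_def by auto
  obtain u2 \<gamma>2 where h2: "horizontal mar_X1 mar_X2 u2 \<gamma>2" "\<gamma>2 0 = (xq, yq, zq)" "\<gamma>2 1 = (a, y, z)"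
    and l2_eq: "l2 = integral {0..1} (\<lambda>s. norm (u2 s))"
    using l2 unfolding sr_lengths_def by auto
  have n1: "norm (xq, yq) \<le> l1" and n2: "norm (a - xq, y - yq) \<le> l2"
    using planar_detour[OF h1(1), of 0] planar_detour[OF h2(1), of 0]
    by (simp_all add: h1 h2 l1_eq l2_eq planar_def)
  have yq: "yq \<le> l1" using n1 norm_snd_le[of yq xq] by simp
  \<comment> \<open>The total length exceeds \<open>y\<close> by at most \<open>\<delta>\<close>, which confines both curves to a thin ellipse.\<close>
  have region: "\<bar>x\<bar> \<le> a * \<kappa>" "- \<delta> \<le> y'" "y' \<le> y + \<delta>"
    if "norm (x, y') + norm (a - x, y - y') \<le> L" for x y'
  proof -
    note e = planar_ellipse[OF that]
    have "L\<^sup>2 - y\<^sup>2 = (L - y) * (L + y)" by (simp add: power2_eq_square algebra_simps)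
    also have "\<dots> \<le> \<delta> * 4"
    proof (cases "0 \<le> L - y")
      case True
      then show ?thesis using L \<delta> \<delta>8 y by (intro mult_mono) auto
    next
      case False
      moreover have "0 \<le> L + y" using e(2) y by linarith
      ultimately have "(L - y) * (L + y) \<le> 0" by (intro mult_nonpos_nonneg) auto
      then show ?thesis using \<delta> by linarith
    qed
    finally have "(2 * x - a)\<^sup>2 \<le> a\<^sup>2 * (2 * \<kappa> + 2)" using e(1) by (simp add: \<delta>_def algebra_simps)
    also have "\<dots> \<le> a\<^sup>2 * (2 * \<kappa> - 1)\<^sup>2"
    proof (intro mult_left_mono)
      have "8 * \<kappa> \<le> \<kappa> * \<kappa>" using \<kappa> by (intro mult_right_mono) auto
      moreover have "(2 * \<kappa> - 1)\<^sup>2 = 4 * (\<kappa> * \<kappa>) - 4 * \<kappa> + 1"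
        by (simp add: power2_eq_square algebra_simps)
      ultimately show "2 * \<kappa> + 2 \<le> (2 * \<kappa> - 1)\<^sup>2" using \<kappa> by linarith
    qed auto
    also have "\<dots> = (a * (2 * \<kappa> - 1))\<^sup>2" by (simp add: power_mult_distrib)
    finally have "\<bar>2 * x - a\<bar> \<le> a * (2 * \<kappa> - 1)"
      using a \<kappa> by (simp add: power2_le_iff_abs_le)
    then have "\<bar>2 * x - a\<bar> \<le> 2 * (a * \<kappa>) - a" by (simp add: algebra_simps)
    then show "\<bar>x\<bar> \<le> a * \<kappa>" using a by linarith
    show "- \<delta> \<le> y'" "y' \<le> y + \<delta>" using e(2) L \<delta> by linarith+
  qed
  have r1: "norm (x, y') + norm (a - x, y - y') \<le> L"
    if "s \<in> {0..1}" "\<gamma>1 s = (x, y', z')" for s x y' z'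
  proof -
    have "norm (x, y') + norm (xq - x, yq - y') \<le> l1"
      using planar_detour[OF h1(1) that(1)] by (simp add: h1 that l1_eq planar_def)
    moreover have "norm (a - x, y - y') \<le> norm (xq - x, yq - y') + norm (a - xq, y - yq)"
      using norm_triangle_ineq[of "(xq - x, yq - y')" "(a - xq, y - yq)"] by simp
    ultimately show ?thesis using n2 by (simp add: L_def)
  qed
  have r2: "norm (x, y') + norm (a - x, y - y') \<le> L"
    if "s \<in> {0..1}" "\<gamma>2 s = (x, y', z')" for s x y' z'
  proof -
    have "norm (x - xq, y' - yq) + norm (a - x, y - y') \<le> l2"
      using planar_detour[OF h2(1) that(1)] by (simp add: h2 that l2_eq planar_def)
    moreover have "norm (x, y') \<le> norm (xq, yq) + norm (x - xq, y' - yq)"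
      using norm_triangle_ineq[of "(xq, yq)" "(x - xq, y' - yq)"] by simp
    ultimately show ?thesis using n1 by (simp add: L_def)
  qed
  have x4: "\<kappa> ^ 4 * x\<^sup>2 \<le> 1" if "\<bar>x\<bar> \<le> a * \<kappa>" for x
  proof -
    have "x\<^sup>2 \<le> (a * \<kappa>)\<^sup>2" using that by (metis abs_ge_zero power2_abs power_mono)
    then have "\<kappa> ^ 4 * x\<^sup>2 \<le> \<kappa> ^ 4 * (a * \<kappa>)\<^sup>2" by (intro mult_left_mono) auto
    also have "\<dots> = \<kappa> ^ 6 * a\<^sup>2" by (simp add: power_mult_distrib flip: power_add)
    finally show ?thesis using \<kappa>6 by linarith
  qed
  have \<kappa>2: "64 \<le> \<kappa>\<^sup>2" using power_mono[OF \<kappa>, of 2] by simp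
  have first: "yq - c * zq + \<kappa> / 4 * xq\<^sup>2 \<le> l1" if c: "\<kappa>\<^sup>2 / 2 \<le> c" "c \<le> 3 * \<kappa>\<^sup>2 / 2" for c
  proof -
    have "(0 * y' + \<kappa> / 2)\<^sup>2 + (c - 0)\<^sup>2 * x\<^sup>2 / 4 \<le> c - 0"
      if s: "s \<in> {0..1}" "\<gamma>1 s = (x, y', z')" for s x y' z'
    proof -
      have x: "\<kappa> ^ 4 * x\<^sup>2 \<le> 1" by (intro x4 region(1)[OF r1[OF s]])
      have "c\<^sup>2 \<le> (3 * \<kappa>\<^sup>2 / 2)\<^sup>2" using c \<kappa>2 by (intro power_mono) linarith+
      also have "\<dots> = 9/4 * \<kappa> ^ 4" by (simp add: power_divide power_mult_distrib flip: power_mult)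
      finally have "c\<^sup>2 * x\<^sup>2 \<le> 9/4 * \<kappa> ^ 4 * x\<^sup>2" by (intro mult_right_mono) auto
      then have "c\<^sup>2 * x\<^sup>2 \<le> 9/4" using x by linarith
      then show ?thesis using c \<kappa>2 by (simp add: power_divide)
    qed
    from mar_calibration[OF h1(1) this h1(2,3)] show ?thesis
      by (simp add: l1_eq)
  qed
  define \<phi> where "\<phi> = (\<lambda>y'. \<kappa> * y' + (\<kappa> - 1 - \<kappa> * y))"
  have second: "(y - \<kappa>\<^sup>2 * z + (\<kappa> - 1) * a\<^sup>2 / 2) - (yq - \<kappa>\<^sup>2 * zq + \<phi> yq * xq\<^sup>2 / 2) \<le> l2"
  proof -
    have "(\<phi> y')\<^sup>2 + (\<kappa>\<^sup>2 - \<kappa>)\<^sup>2 * x\<^sup>2 / 4 \<le> \<kappa>\<^sup>2 - \<kappa>"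
      if s: "s \<in> {0..1}" "\<gamma>2 s = (x, y', z')" for s x y' z'
    proof -
      have x: "\<kappa> ^ 4 * x\<^sup>2 \<le> 1" by (intro x4 region(1)[OF r2[OF s]])
      have "(\<kappa>\<^sup>2 - \<kappa>)\<^sup>2 \<le> (\<kappa>\<^sup>2)\<^sup>2"
      proof (intro power_mono)
        have "\<kappa> * 1 \<le> \<kappa> * \<kappa>" using \<kappa> by (intro mult_left_mono) auto
        then show "0 \<le> \<kappa>\<^sup>2 - \<kappa>" by (simp add: power2_eq_square)
      qed (use \<kappa> in auto)
      then have "(\<kappa>\<^sup>2 - \<kappa>)\<^sup>2 * x\<^sup>2 \<le> \<kappa> ^ 4 * x\<^sup>2"
        by (intro mult_right_mono) (auto simp flip: power_mult)
      moreover have "(\<phi> y')\<^sup>2 \<le> (\<kappa> - 3/4)\<^sup>2"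
      proof -
        have "\<kappa> * y' \<le> \<kappa> * (y + \<delta>)" "\<kappa> * (- \<delta>) \<le> \<kappa> * y'" "\<kappa> * y \<le> \<kappa> * (3/2)"
          using \<kappa> y(2) by (intro mult_left_mono region(2,3)[OF r2[OF s]]; simp)+
        then have "\<phi> y' \<le> \<kappa> - 3/4" "- \<phi> y' \<le> \<kappa> - 3/4"
          using \<delta>(2) \<kappa> unfolding \<phi>_def distrib_left mult_minus_right by linarith+
        then show ?thesis by (intro power2_le_iff_abs_le[THEN iffD2]) auto
      qed
      moreover have "(\<kappa> - 3/4)\<^sup>2 = \<kappa>\<^sup>2 - 3/2 * \<kappa> + 9/16"
        by (simp add: power2_diff power_divide)
      ultimately show ?thesis using x \<kappa> by linarith
    qed
    from mar_calibration[OF h2(1) this[unfolded \<phi>_def] h2(2,3)] show ?thesis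
      by (simp add: l2_eq \<phi>_def)
  qed
  \<comment> \<open>The slope after \<open>q\<close> starts below the slope before \<open>q\<close>, as \<open>y - yq\<close> is almost \<open>1/2\<close> or more.\<close>
  have gap: "1/2 \<le> \<kappa> / 2 - \<phi> yq"
  proof -
    have "\<kappa> * (1/2 - \<delta>) \<le> \<kappa> * (y - yq)"
      using yq half y(1) \<kappa> unfolding \<delta>_def by (intro mult_left_mono) linarith+
    then show ?thesis using \<delta>(2) by (simp add: \<phi>_def algebra_simps)
  qed
  have main: "(\<kappa>\<^sup>2 - c) * zq + xq\<^sup>2 / 4 \<le> 3/2 * a\<^sup>2" if c: "\<kappa>\<^sup>2 / 2 \<le> c" "c \<le> 3 * \<kappa>\<^sup>2 / 2" for c
  proof -
    have "1/2 * (xq\<^sup>2 / 2) \<le> (\<kappa> / 2 - \<phi> yq) * (xq\<^sup>2 / 2)"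
      by (intro mult_right_mono gap) auto
    then show ?thesis
      using first[OF c] second action
      unfolding left_diff_distrib distrib_left diff_divide_distrib add_divide_distrib mult_1
      by (simp add: mult_ac)
  qed
  have m1: "\<kappa>\<^sup>2 / 2 * zq + xq\<^sup>2 / 4 \<le> 3/2 * a\<^sup>2"
    using main[of "\<kappa>\<^sup>2 / 2"] by (simp add: algebra_simps)
  have m2: "- (\<kappa>\<^sup>2 / 2 * zq) + xq\<^sup>2 / 4 \<le> 3/2 * a\<^sup>2"
    using main[of "3 * \<kappa>\<^sup>2 / 2"] by (simp add: algebra_simps)
  show "xq\<^sup>2 \<le> 6 * a\<^sup>2" using m1 m2 by linarith
  have "\<bar>\<kappa>\<^sup>2 * zq\<bar> \<le> 3 * a\<^sup>2"
    using m1 m2 zero_le_power2[of xq] by (intro abs_leI) linarith+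
  then have "\<kappa>\<^sup>2 * \<bar>zq\<bar> \<le> 3 * a\<^sup>2"
    by (simp add: abs_mult)
  then show "\<bar>zq\<bar> \<le> 3 * a\<^sup>2 / \<kappa>\<^sup>2"
    using \<kappa> by (simp add: field_simps)
qed

text \<open>The point \<open>(a, y, z)\<close> is reached by a ramp whose length \<open>r\<close> is dictated by \<open>z\<close>, and the bounds on
  \<open>a\<close> and \<open>z\<close> keep \<open>r\<close> between \<open>1/2\<close> and \<open>1\<close>. For \<open>\<kappa> = (n + 1) / r\<close> the ramp is optimal up to
  \<open>O(a\<^sup>2)\<close>: with \<open>N = n + 1\<close>, its excess length and the term \<open>\<kappa>\<^sup>2 z\<close> add up to
  \<open>(N / (2 N - 1) + N / (2 N + 1)) \<kappa> a\<^sup>2 / 2\<close>, and the factor is \<open>1 + 1 / (4 N\<^sup>2 - 1)\<close>.\<close>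

lemma mar_midpoint_in_box:
  fixes n :: nat and \<epsilon> a y z :: real and q :: "real \<times> real \<times> real"
  assumes n: "7 \<le> n" and \<epsilon>: "0 < \<epsilon>" "9 * (real n + 1) ^ 3 * \<epsilon> \<le> 1"
    and a: "\<epsilon> \<le> a" "a \<le> 11/10 * \<epsilon>" and y: "1 \<le> y" "y \<le> 3/2"
    and z: "7/10 * \<epsilon>\<^sup>2 \<le> 2 * (2 * real n + 3) * z" "2 * (2 * real n + 3) * z \<le> 9/10 * \<epsilon>\<^sup>2"
  shows "mar_dist (0, 0, 0) (a, y, z) \<le> 2"
    and "\<lbrakk>mar_dist (0, 0, 0) q = mar_dist (0, 0, 0) (a, y, z) / 2;
          mar_dist q (a, y, z) = mar_dist (0, 0, 0) (a, y, z) / 2\<rbrakk>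
      \<Longrightarrow> q \<in> {- 3 * \<epsilon>..3 * \<epsilon>} \<times> {- 2..2} \<times> {- (4 * \<epsilon>\<^sup>2 / (real n + 1)\<^sup>2)..4 * \<epsilon>\<^sup>2 / (real n + 1)\<^sup>2}"
proof -
  define N where "N = real n + 1"
  have N: "8 \<le> N" using n by (simp add: N_def)
  define r where "r = 2 * (2 * real n + 3) * z / a\<^sup>2"
  have a0: "0 < a" using \<epsilon> a by simp
  have a2: "\<epsilon>\<^sup>2 \<le> a\<^sup>2" "a\<^sup>2 \<le> 121/100 * \<epsilon>\<^sup>2"
  proof -
    show "\<epsilon>\<^sup>2 \<le> a\<^sup>2" using a \<epsilon> by (intro power_mono) auto
    have "a\<^sup>2 \<le> (11/10 * \<epsilon>)\<^sup>2" using a a0 by (intro power_mono) auto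
    then show "a\<^sup>2 \<le> 121/100 * \<epsilon>\<^sup>2" by (simp add: power_mult_distrib power_divide)
  qed
  have e2: "0 < \<epsilon>\<^sup>2" "0 < a\<^sup>2" using \<epsilon> a0 by auto
  have r: "1/2 \<le> r" "r \<le> 1"
    unfolding r_def using z a2 e2 by (simp_all add: pos_le_divide_eq pos_divide_le_eq)
  have z_eq: "z = a\<^sup>2 * r / (2 * (2 * real n + 3))"
    using a0 by (simp add: r_def)
  define \<kappa> where "\<kappa> = N / r"
  have \<kappa>: "N \<le> \<kappa>" "\<kappa> \<le> 2 * N" "8 \<le> \<kappa>"
  proof -
    show 1: "N \<le> \<kappa>" unfolding \<kappa>_def using N r by (simp add: pos_le_divide_eq mult_left_le)
    show "\<kappa> \<le> 2 * N" unfolding \<kappa>_def using N r by (simp add: pos_divide_le_eq)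
    show "8 \<le> \<kappa>" using 1 N by linarith
  qed
  have rk: "r * \<kappa> = N" using r by (simp add: \<kappa>_def)
  define T where "T = mar_dist (0, 0, 0) (a, y, z)"
  have T: "T \<le> y + a\<^sup>2 * \<kappa> / 2 * (N / (2 * N - 1))"
  proof -
    have "T \<le> y + a\<^sup>2 * N\<^sup>2 / (2 * r * (2 * N - 1))"
      using mar_dist_origin_le[of r y a n] r y by (simp add: T_def z_eq N_def add.commute)
    also have "a\<^sup>2 * N\<^sup>2 / (2 * r * (2 * N - 1)) = a\<^sup>2 * \<kappa> / 2 * (N / (2 * N - 1))"
      by (simp add: \<kappa>_def power2_eq_square mult_ac)
    finally show ?thesis .
  qed
  have kz: "\<kappa>\<^sup>2 * z = a\<^sup>2 * \<kappa> / 2 * (N / (2 * N + 1))"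
  proof -
    have "\<kappa>\<^sup>2 * z = a\<^sup>2 * \<kappa> * (r * \<kappa>) / (2 * (2 * real n + 3))"
      by (simp add: z_eq power2_eq_square mult_ac)
    also have "2 * real n + 3 = 2 * N + 1" by (simp add: N_def)
    finally show ?thesis by (simp add: rk)
  qed
  have T1: "T \<le> y + a\<^sup>2 * \<kappa> / 2"
  proof -
    have "N / (2 * N - 1) \<le> 1" using N by simp
    then have "a\<^sup>2 * \<kappa> / 2 * (N / (2 * N - 1)) \<le> a\<^sup>2 * \<kappa> / 2 * 1"
      using \<kappa> by (intro mult_left_mono) auto
    then show ?thesis using T unfolding mult_1_right by linarith
  qed
  have T2: "T + \<kappa>\<^sup>2 * z \<le> y + a\<^sup>2 * (\<kappa> + 1) / 2"
  proof -
    have N2: "0 < 4 * N\<^sup>2 - 1" "2 * N \<le> 4 * N\<^sup>2 - 1"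
    proof -
      have "8 * N \<le> N * N" using N by (intro mult_right_mono) auto
      then show "2 * N \<le> 4 * N\<^sup>2 - 1" using N unfolding power2_eq_square by linarith
      then show "0 < 4 * N\<^sup>2 - 1" using N by linarith
    qed
    have "N / (2 * N - 1) + N / (2 * N + 1) = 4 * N\<^sup>2 / (4 * N\<^sup>2 - 1)"
    proof -
      have "N / (2 * N - 1) + N / (2 * N + 1) = (N * (2 * N + 1) + N * (2 * N - 1)) / ((2 * N - 1) * (2 * N + 1))"
        using N by (subst add_frac_eq) auto
      also have "N * (2 * N + 1) + N * (2 * N - 1) = 4 * N\<^sup>2" by (simp add: power2_eq_square algebra_simps)
      also have "(2 * N - 1) * (2 * N + 1) = 4 * N\<^sup>2 - 1" by (simp add: power2_eq_square algebra_simps)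
      finally show ?thesis .
    qed
    also have "\<dots> = 1 + 1 / (4 * N\<^sup>2 - 1)" using N2 by (simp add: field_simps)
    finally have s: "N / (2 * N - 1) + N / (2 * N + 1) = 1 + 1 / (4 * N\<^sup>2 - 1)" .
    have "T + \<kappa>\<^sup>2 * z \<le> y + a\<^sup>2 * \<kappa> / 2 * (N / (2 * N - 1) + N / (2 * N + 1))"
      using T kz by (simp add: distrib_left)
    also have "\<dots> = y + a\<^sup>2 / 2 * (\<kappa> + \<kappa> / (4 * N\<^sup>2 - 1))"
      unfolding s by (simp add: algebra_simps)
    also have "\<dots> \<le> y + a\<^sup>2 / 2 * (\<kappa> + 1)"
      using \<kappa>(2) N2 by (intro add_left_mono mult_left_mono) auto
    finally show ?thesis by simp
  qed
  have \<kappa>a: "\<kappa> ^ 3 * a \<le> 1"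
  proof -
    have "\<kappa> ^ 3 * a \<le> (2 * N) ^ 3 * (11/10 * \<epsilon>)"
      using \<kappa> a a0 by (intro mult_mono power_mono) auto
    also have "\<dots> \<le> 9 * N ^ 3 * \<epsilon>"
      using N \<epsilon> by (simp add: power_mult_distrib)
    also have "\<dots> \<le> 1" using \<epsilon>(2) by (simp add: N_def)
    finally show ?thesis .
  qed
  have a2\<kappa>: "a\<^sup>2 * (\<kappa> + 1) \<le> 1/8"
  proof -
    have 1: "\<kappa> * a \<le> 1/8"
    proof -
      have "8\<^sup>2 \<le> \<kappa>\<^sup>2" using \<kappa> by (intro power_mono) auto
      then have "64 * (\<kappa> * a) \<le> \<kappa>\<^sup>2 * (\<kappa> * a)" using \<kappa> a0 by (intro mult_right_mono) auto
      also have "\<dots> \<le> 1" using \<kappa>a by (simp add: power2_eq_square power3_eq_cube mult.assoc)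
      finally show ?thesis by linarith
    qed
    have "8 * a \<le> \<kappa> * a" using \<kappa> a0 by (intro mult_right_mono) auto
    then have "a * (\<kappa> + 1) \<le> 2/8" "a \<le> 1/64" using 1 by (simp_all add: algebra_simps)
    then have "a * (a * (\<kappa> + 1)) \<le> 1/64 * (2/8)" using a0 \<kappa> by (intro mult_mono) auto
    then show ?thesis by (simp add: power2_eq_square algebra_simps)
  qed
  show "mar_dist (0, 0, 0) (a, y, z) \<le> 2"
    using T1 a2\<kappa> y e2 unfolding T_def distrib_left mult_1_right by linarith
  assume q: "mar_dist (0, 0, 0) q = mar_dist (0, 0, 0) (a, y, z) / 2"
    "mar_dist q (a, y, z) = mar_dist (0, 0, 0) (a, y, z) / 2"
  obtain xq yq zq where q_eq: "q = (xq, yq, zq)" by (cases q)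
  \<comment> \<open>The distances are only infima; the slack \<open>a\<^sup>2 / 4\<close> on each half is within the tolerated gap.\<close>
  obtain l1 where l1: "l1 \<in> sr_lengths mar_X1 mar_X2 (0, 0, 0) q" "l1 < T / 2 + a\<^sup>2 / 4"
    using mar_dist_nearly_attained[of "(0, 0, 0)" q "T / 2 + a\<^sup>2 / 4"] q e2 by (auto simp: T_def)
  obtain l2 where l2: "l2 \<in> sr_lengths mar_X1 mar_X2 q (a, y, z)" "l2 < T / 2 + a\<^sup>2 / 4"
    using mar_dist_nearly_attained[of q "(a, y, z)" "T / 2 + a\<^sup>2 / 4"] q e2 by (auto simp: T_def)
  have ex: "l1 + l2 \<le> y + a\<^sup>2 * (\<kappa> + 1) / 2" "l1 + l2 + \<kappa>\<^sup>2 * z \<le> y + a\<^sup>2 * (\<kappa> + 2) / 2"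
    "l1 \<le> y / 2 + a\<^sup>2 * (\<kappa> + 1) / 2"
  proof -
    have k0: "0 \<le> a\<^sup>2 * \<kappa>" using \<kappa> by simp
    have d: "a\<^sup>2 * (\<kappa> + 1) = a\<^sup>2 * \<kappa> + a\<^sup>2" "a\<^sup>2 * (\<kappa> + 2) = a\<^sup>2 * \<kappa> + 2 * a\<^sup>2"
      by (simp_all add: algebra_simps)
    note facts = l1(2) l2(2) T1 T2[unfolded d add_divide_distrib] k0 e2
    show "l1 + l2 \<le> y + a\<^sup>2 * (\<kappa> + 1) / 2"
      unfolding d add_divide_distrib using facts by linarith
    show "l1 + l2 + \<kappa>\<^sup>2 * z \<le> y + a\<^sup>2 * (\<kappa> + 2) / 2"
      unfolding d add_divide_distrib using facts by linarith
    show "l1 \<le> y / 2 + a\<^sup>2 * (\<kappa> + 1) / 2"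
      unfolding d add_divide_distrib using facts by linarith
  qed
  note est = midpoint_estimate[OF \<kappa>(3) a0 \<kappa>a y l1(1)[unfolded q_eq] l2(1)[unfolded q_eq] ex]
  have "\<bar>xq\<bar> \<le> 3 * \<epsilon>"
  proof -
    have "xq\<^sup>2 \<le> 9 * \<epsilon>\<^sup>2"
      using est(1) a2(2) e2 by linarith
    then have "xq\<^sup>2 \<le> (3 * \<epsilon>)\<^sup>2"
      by (simp add: power_mult_distrib)
    then show ?thesis
      by (rule power2_le_iff_abs_le[THEN iffD1, rotated]) (use \<epsilon> in simp)
  qed
  moreover have "\<bar>yq\<bar> \<le> 2"
    using mar_length_bounds(2)[OF l1(1)[unfolded q_eq]] ex(3) a2\<kappa> y by simp
  moreover have "\<bar>zq\<bar> \<le> 4 * \<epsilon>\<^sup>2 / N\<^sup>2"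
  proof -
    have "3 * a\<^sup>2 / \<kappa>\<^sup>2 \<le> 4 * \<epsilon>\<^sup>2 / N\<^sup>2"
      using a2 e2 \<kappa> N by (intro frac_le power_mono) auto
    then show ?thesis using est(2) by linarith
  qed
  ultimately show "q \<in> {- 3 * \<epsilon>..3 * \<epsilon>} \<times> {- 2..2}
      \<times> {- (4 * \<epsilon>\<^sup>2 / (real n + 1)\<^sup>2)..4 * \<epsilon>\<^sup>2 / (real n + 1)\<^sup>2}"
    by (auto simp: q_eq N_def abs_le_iff)
qed


section \<open>Failure of the measure contraction property\<close>

lemma emeasure_lborel_box3:
  fixes a b c d e f :: real
  assumes "a \<le> b" "c \<le> d" "e \<le> f"
  shows "emeasure lborel ({a..b} \<times> {c..d} \<times> {e..f}) = ennreal ((b - a) * (d - c) * (f - e))"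
proof -
  have "emeasure lborel ({a..b} \<times> {c..d} \<times> {e..f}) = ennreal (b - a) * (ennreal (d - c) * ennreal (f - e))"
    unfolding lborel_prod[symmetric]
    by (subst lborel_pair.emeasure_pair_measure_Times)
       (simp_all add: lborel_prod[symmetric] lborel.emeasure_pair_measure_Times assms)
  then show ?thesis
    using assms by (simp add: ennreal_mult[symmetric] mult.assoc)
qed

theorem theorem1p1:
  fixes K N c :: real
  assumes "1 \<le> N" and "0 < c"
  shows "\<not> MCP Mar (scale_measure (ennreal c) lborel) K N"
proof
  define m where "m = scale_measure (ennreal c) (lborel :: (real \<times> real \<times> real) measure)"
  assume "MCP Mar (scale_measure (ennreal c) lborel) K N"
  then have MCP: "MCP Mar m K N" by (simp add: m_def)
  have sm: "sets m = sets (mborel Mar)" by (simp add: m_def sets_mborel_Mar)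
  obtain k where k: "0 < k"
    and contr: "\<And>x0 A B. \<lbrakk>x0 \<in> mspace Mar; A \<in> sets m; B \<in> sets m; 0 < emeasure m A; emeasure m A < \<infinity>;
        uniform_measure m A \<in> Pc Mar; \<And>p. p \<in> A \<Longrightarrow> mdist Mar p x0 \<le> 2;
        \<And>p q. \<lbrakk>p \<in> A; q \<in> mspace Mar; mdist Mar p q = mdist Mar p x0 / 2; mdist Mar q x0 = mdist Mar p x0 / 2\<rbrakk>
          \<Longrightarrow> q \<in> B\<rbrakk>
      \<Longrightarrow> ennreal k * emeasure m A \<le> emeasure m B"
    using MCP_midpoints_measure[OF assms(1) MCP sm, of 2] by blast
  \<comment> \<open>The volumes turn out to satisfy \<open>k (n + 1)\<^sup>2 \<le> 38400 (2 n + 3) \<le> 115200 (n + 1)\<close>.\<close>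
  obtain n0 :: nat where n0: "115200 / k < real n0" using reals_Archimedean2 by blast
  define n where "n = max n0 7"
  have n: "7 \<le> n" "115200 / k < real n" using n0 by (auto simp: n_def)
  define \<epsilon> where "\<epsilon> = 1 / (9 * (real n + 1) ^ 3)"
  have \<epsilon>: "0 < \<epsilon>" "9 * (real n + 1) ^ 3 * \<epsilon> \<le> 1"
    by (simp_all add: \<epsilon>_def add_pos_pos add_nonneg_pos)
  \<comment> \<open>\<open>h\<close> is the last coordinate reached by a ramp of length 1 ending at \<open>x = \<epsilon>\<close>.\<close>
  define h where "h = \<epsilon>\<^sup>2 / (2 * (2 * real n + 3))"
  have h: "0 < h" "2 * (2 * real n + 3) * h = \<epsilon>\<^sup>2" using \<epsilon> by (simp_all add: h_def add_nonneg_pos)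
  define w where "w = 4 * \<epsilon>\<^sup>2 / (real n + 1)\<^sup>2"
  have w: "0 \<le> w" by (simp add: w_def)
  define A where "A = {\<epsilon>..11/10 * \<epsilon>} \<times> {1..3/2 :: real} \<times> {7/10 * h..9/10 * h}"
  define B where "B = {- 3 * \<epsilon>..3 * \<epsilon>} \<times> {- 2..2 :: real} \<times> {- w..w}"
  have A: "emeasure m A = ennreal (c * (\<epsilon> * h / 100))"
    using \<epsilon> h assms(2) unfolding A_def m_def
    by (simp add: emeasure_lborel_box3 ennreal_mult[symmetric] field_simps)
  have B: "emeasure m B = ennreal (c * (48 * \<epsilon> * w))"
    using \<epsilon> w assms(2) unfolding B_def m_def
    by (simp add: emeasure_lborel_box3 ennreal_mult[symmetric] field_simps)
  have cA: "compact A" unfolding A_def by (intro compact_Times) auto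
  have cB: "compact B" unfolding B_def by (intro compact_Times) auto
  have A0: "0 < emeasure m A" "emeasure m A < \<infinity>"
    unfolding A using assms(2) \<epsilon> h by simp_all
  have inA: "\<epsilon> \<le> a \<and> a \<le> 11/10 * \<epsilon> \<and> 1 \<le> y \<and> y \<le> 3/2
      \<and> 7/10 * \<epsilon>\<^sup>2 \<le> 2 * (2 * real n + 3) * z \<and> 2 * (2 * real n + 3) * z \<le> 9/10 * \<epsilon>\<^sup>2"
    if "(a, y, z) \<in> A" for a y z
  proof -
    have t: "2 * (2 * real n + 3) * (t * h) = t * \<epsilon>\<^sup>2" for t
      by (simp flip: h(2))
    have "2 * (2 * real n + 3) * (7/10 * h) \<le> 2 * (2 * real n + 3) * z"
      "2 * (2 * real n + 3) * z \<le> 2 * (2 * real n + 3) * (9/10 * h)"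
      using that unfolding A_def by (auto intro!: mult_left_mono)
    then show ?thesis
      using that unfolding t by (simp add: A_def)
  qed
  have "ennreal k * emeasure m A \<le> emeasure m B"
  proof (rule contr[of "(0, 0, 0)"])
    show "A \<in> sets m" "B \<in> sets m"
      using cA cB by (auto simp: sm sets_mborel_Mar intro: borel_compact)
    show "uniform_measure m A \<in> Pc Mar"
      using cA by (intro uniform_measure_in_Pc sm A0)
        (auto simp: mtopology_of_Mar compact_imp_closed closed_closedin[symmetric])
    fix p assume p: "p \<in> A"
    obtain a y z where pe: "p = (a, y, z)" by (cases p)
    have dist: "mdist Mar p (0, 0, 0) = mar_dist (0, 0, 0) (a, y, z)"
      by (simp add: pe mar_dist_commute[of "(a, y, z)"])
    have "(a, y, z) \<in> A" using p pe by simp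
    from inA[OF this] have ayz: "\<epsilon> \<le> a" "a \<le> 11/10 * \<epsilon>" "1 \<le> y" "y \<le> 3/2"
      "7/10 * \<epsilon>\<^sup>2 \<le> 2 * (2 * real n + 3) * z" "2 * (2 * real n + 3) * z \<le> 9/10 * \<epsilon>\<^sup>2"
      by blast+
    show "mdist Mar p (0, 0, 0) \<le> 2"
      unfolding dist by (rule mar_midpoint_in_box(1)[OF n(1) \<epsilon> ayz])
    fix q assume q: "mdist Mar p q = mdist Mar p (0, 0, 0) / 2" "mdist Mar q (0, 0, 0) = mdist Mar p (0, 0, 0) / 2"
    show "q \<in> B"
      unfolding B_def w_def
    proof (rule mar_midpoint_in_box(2)[OF n(1) \<epsilon> ayz])
      show "mar_dist (0, 0, 0) q = mar_dist (0, 0, 0) (a, y, z) / 2"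
        using q(2)[unfolded dist] unfolding mdist_Mar by (subst mar_dist_commute)
      show "mar_dist q (a, y, z) = mar_dist (0, 0, 0) (a, y, z) / 2"
        using q(1)[unfolded dist] unfolding mdist_Mar pe by (subst mar_dist_commute)
    qed
  qed (use A0 in auto)
  then have "k * (c * (\<epsilon> * h / 100)) \<le> c * (48 * \<epsilon> * w)"
    unfolding A B using k assms(2) \<epsilon> h w by (simp add: ennreal_mult[symmetric])
  then have "(c * \<epsilon> / 100) * (k * h) \<le> (c * \<epsilon> / 100) * (4800 * w)"
    by (simp add: algebra_simps)
  then have "k * h \<le> 4800 * w"
    by (rule mult_left_le_imp_le) (use assms(2) \<epsilon> in simp)
  then have "(k * h) * (2 * (2 * real n + 3) * (real n + 1)\<^sup>2) \<le> (4800 * w) * (2 * (2 * real n + 3) * (real n + 1)\<^sup>2)"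
    by (rule mult_right_mono) simp
  moreover have "(k * h) * (2 * (2 * real n + 3) * (real n + 1)\<^sup>2) = \<epsilon>\<^sup>2 * (k * (real n + 1)\<^sup>2)"
    by (simp flip: h(2))
  moreover have "(4800 * w) * (2 * (2 * real n + 3) * (real n + 1)\<^sup>2) = \<epsilon>\<^sup>2 * (38400 * (2 * real n + 3))"
  proof -
    have "w * (real n + 1)\<^sup>2 = 4 * \<epsilon>\<^sup>2" by (simp add: w_def add_nonneg_pos)
    then show ?thesis by (simp add: mult.assoc mult.left_commute[of w])
  qed
  ultimately have "\<epsilon>\<^sup>2 * (k * (real n + 1)\<^sup>2) \<le> \<epsilon>\<^sup>2 * (38400 * (2 * real n + 3))"
    by (simp only:)
  then have "k * (real n + 1)\<^sup>2 \<le> 38400 * (2 * real n + 3)"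
    by (rule mult_left_le_imp_le) (use \<epsilon> in simp)
  also have "\<dots> \<le> 115200 * (real n + 1)" by simp
  finally have "(k * (real n + 1)) * (real n + 1) \<le> 115200 * (real n + 1)"
    by (simp add: power2_eq_square mult.assoc)
  then have "k * (real n + 1) \<le> 115200"
    by (rule mult_right_le_imp_le) simp
  moreover have "115200 < k * real n"
    using n(2) k by (simp add: field_simps)
  ultimately show False
    using k by (simp add: algebra_simps)
qed

end
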